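(* The $P$-Voros coefficient $W(c,\eta)$ of $(P_{\rm II})$ is given explicitly by the formal power series $$W(c,\eta)=-\sum_{n=1}^{\infty}\frac{2^{1-2n}-1}{2n(2n-1)}\,B_{2n}\,(c\,\eta)^{1-2n},$$ where $B_{2n}$ are the Bernoulli numbers defined by $\frac{w}{e^w-1}=1-\frac w2+\sum_{n\ge1}\frac{B_{2n}}{(2n)!}w^{2n}$.
   Context: Let $\eta$ be a large parameter and $c\in\mathbb C\setminus\{0\}$ with $\arg c$ close to $\pi/2$. The second Painlevé equation with a large parameter is $(P_{\rm II})$: $\frac{d^2\lambda}{dt^2}=\eta^2(2\lambda^3+t\lambda+c)$, equivalently the Hamiltonian system $(H_{\rm II})$: $\frac{d\lambda}{dt}=\eta\nu$, $\frac{d\nu}{dt}=\eta(2\lambda^3+t\lambda+c)$. Let $\lambda_0(t,c)$ be a branch of the algebraic function defined by $2\lambda_0^3+t\lambda_0+c=0$. The 0-parameter solution is the unique pair of formal power series $\lambda^{(0)}=\sum_{k\ge0}\eta^{-k}\lambda^{(0)}_k(t,c)$, $\nu^{(0)}=\sum_{k\ge0}\eta^{-k}\nu^{(0)}_k(t,c)$ solving $(H_{\rm II})$ formally with $\lambda^{(0)}_0=\lambda_0$, $\nu^{(0)}_0=0$. Set $\Delta(t,c)=6\lambda_0^2+t$; its zeros $\tau_j=-6(c/4)^{2/3}e^{2\pi ij/3}$ ($j=1,2,3$) are the $P$-turning points, and $P$-Stokes curves are the curves ${\rm Im}\int_{\tau_j}^t\sqrt{\Delta}\,dt=0$. Let $R=\sum_{k\ge-1}\eta^{-k}R_k(t,c)$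 be the formal solution of the Riccati equation $R^2+\frac{dR}{dt}=\eta^2\big(6(\lambda^{(0)})^2+t\big)$ with $R_{-1}=\sqrt{\Delta}$ (the $R_k$, $k\ge0$, are then uniquely determined recursively), $R^\dagger$ the solution with $R^\dagger_{-1}=-\sqrt\Delta$, and $R_{\rm odd}=\frac12(R-R^\dagger)=\sum_{k\ge0}\eta^{1-2k}R_{2k-1}$. Branch convention: $\Gamma$ is the $P$-Stokes curve emanating from $\tau_1$ and running to $t=\infty$ along which (with ${\rm Re}\,t^{1/2}>0$) $\lambda_0\sim-\frac{i}{\sqrt2}t^{1/2}$ and $\sqrt\Delta\sim-\sqrt2\,i\,t^{1/2}$ as $t\to\infty$; this fixes the branches of $\lambda_0$ and $\sqrt\Delta$. The $P$-Voros coefficient is $W(c,\eta)=\frac12\int_{\Gamma_\infty}\big(R_{\rm odd}-\eta R_{-1}\big)\,dt$, integrated coefficientwise in $\eta^{-1}$, where $\Gamma_\infty$ is a path on the Riemann surface of $\sqrt\Delta$ that starts at $t=\infty$ on the sheet where $\sqrt\Delta$ has the opposite sign, comes along $\Gamma$ to $\tau_1$, encircles $\tau_1$, and returns to $t=\infty$ along $\Gamma$ on the sheet fixed above (this is the meaning of $\int_{\tau_1}^\infty$; the coefficients are integrable at $\infty$). *)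

theory Defs
  imports "HOL-Analysis.Analysis" "HOL-Computational_Algebra.Formal_Power_Series"
begin

definition bernoulli_num :: "nat \<Rightarrow> real" where
  "bernoulli_num m = fact m * fps_nth (fps_X / (fps_exp (1::real) - 1)) m"

definition tau1 :: "complex \<Rightarrow> complex" where
  "tau1 c = - 6 * (c / 4) powr (2/3) * exp (2 * pi * \<i> / 3)"

text \<open>A point (t, l, s) of the Riemann surface of sqrt Delta away from turning points:
  l is a root lambda_0 of 2 l^3 + t l + c = 0 and s is a value of sqrt(6 l^2 + t), s nonzero.\<close>
definition on_surf :: "complex \<Rightarrow> complex \<Rightarrow> complex \<Rightarrow> complex \<Rightarrow> bool" where
  "on_surf c t l s \<longleftrightarrow> 2 * l^3 + t * l + c = 0 \<and> s^2 = 6 * l^2 + t \<and> s \<noteq> 0"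

definition loc_branch :: "complex \<Rightarrow> complex set \<Rightarrow> (complex \<Rightarrow> complex) \<Rightarrow> (complex \<Rightarrow> complex) \<Rightarrow> bool" where
  "loc_branch c U lb sb \<longleftrightarrow> open U \<and> lb holomorphic_on U \<and> sb holomorphic_on U \<and>
     (\<forall>t\<in>U. on_surf c t (lb t) (sb t))"

text \<open>The 0-parameter solution: lam n, nu n are the coefficients of eta^(-n) of lambda^(0), nu^(0);
  the conditions are the coefficientwise comparison of the Hamiltonian system (H_II):
  coefficient of eta^(-n) in d lambda/dt = eta nu, and of eta^(-n) in d nu/dt = eta (2 lambda^3 + t lambda + c)
  (the eta^1 coefficient 2 lambda_0^3 + t lambda_0 + c = 0 holds since lam 0 = lb is a branch of lambda_0).\<close>
definition zero_param_sol :: "complex \<Rightarrow> complex set \<Rightarrow> (complex \<Rightarrow> complex) \<Rightarrow>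
    (nat \<Rightarrow> complex \<Rightarrow> complex) \<Rightarrow> (nat \<Rightarrow> complex \<Rightarrow> complex) \<Rightarrow> bool" where
  "zero_param_sol c U lb lam nu \<longleftrightarrow>
     (\<forall>n. lam n holomorphic_on U \<and> nu n holomorphic_on U) \<and>
     (\<forall>t\<in>U. lam 0 t = lb t \<and> nu 0 t = 0 \<and>
        (\<forall>n. deriv (lam n) t = nu (n + 1) t \<and>
             deriv (nu n) t = 2 * (\<Sum>a\<le>n+1. \<Sum>b\<le>n+1-a. lam a t * lam b t * lam (n+1-a-b) t)
                              + t * lam (n + 1) t))"

text \<open>Formal solution of the Riccati equation R^2 + dR/dt = eta^2 (6 (lambda^(0))^2 + t).
  Index shift: Rr j is the coefficient R_(j-1) of eta^(1-j) (j = 0, 1, 2, ...), and Rr 0 = sb = sqrt Delta.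
  The condition is the comparison of coefficients of eta^(2-m).\<close>
definition riccati_sol :: "complex \<Rightarrow> complex set \<Rightarrow> (nat \<Rightarrow> complex \<Rightarrow> complex) \<Rightarrow>
    (complex \<Rightarrow> complex) \<Rightarrow> (nat \<Rightarrow> complex \<Rightarrow> complex) \<Rightarrow> bool" where
  "riccati_sol c U lam sb Rr \<longleftrightarrow>
     (\<forall>j. Rr j holomorphic_on U) \<and>
     (\<forall>t\<in>U. Rr 0 t = sb t \<and>
        (\<forall>m. (\<Sum>i\<le>m. Rr i t * Rr (m - i) t) + (if m = 0 then 0 else deriv (Rr (m - 1)) t)
             = 6 * (\<Sum>a\<le>m. lam a t * lam (m - a) t) + (if m = 0 then t else 0)))"

text \<open>Value at the surface point (t0, l0, s0) of the coefficient R_(j-1) of the Riccati solution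
  with R_(-1) = sqrt Delta, computed on any local holomorphic branch through that point.\<close>
definition Rcoef :: "complex \<Rightarrow> nat \<Rightarrow> complex \<Rightarrow> complex \<Rightarrow> complex \<Rightarrow> complex" where
  "Rcoef c j t0 l0 s0 = (THE v. \<exists>U lb sb lam nu Rr. t0 \<in> U \<and> lb t0 = l0 \<and> sb t0 = s0 \<and>
      loc_branch c U lb sb \<and> zero_param_sol c U lb lam nu \<and> riccati_sol c U lam sb Rr \<and>
      v = Rr j t0)"

text \<open>Coefficient of eta^(1-j) in R_odd = (R - R^dagger)/2; R^dagger is the solution with R_(-1) = -sqrt Delta.\<close>
definition Rodd :: "complex \<Rightarrow> nat \<Rightarrow> complex \<Rightarrow> complex \<Rightarrow> complex \<Rightarrow> complex" where
  "Rodd c j t l s = (Rcoef c j t l s - Rcoef c j t l (- s)) / 2"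

text \<open>Claimed coefficient of eta^(1-j) (j \<ge> 1) of W(c, eta):
  -(2^(1-2n) - 1)/(2n(2n-1)) B_(2n) c^(1-2n) for j = 2n, and 0 for odd j.\<close>
definition W_target :: "complex \<Rightarrow> nat \<Rightarrow> complex" where
  "W_target c j = (if even j then
      - complex_of_real ((2 powr (1 - real j) - 1) / (real j * (real j - 1)) * bernoulli_num j)
        * inverse (c ^ (j - 1))
    else 0)"

end

(*
  Write l = lambda_0, s = sqrt Delta, x = l/s and q(x) = 4x^3 - x.  Then c = s^3 q(x) and
  t = s^2 (1 - 6x^2), so by homogeneity R_(j-1) = s c^(-j) r_j(x) with universal polynomials r_j
  divisible by q^j.  At fixed c one has dx/dt = (3/2) q(x) / s^2, hence, for j >= 2,
  R_(j-1) dt = c^(1-j) dP_j(x) with the polynomial P_j given by P_j' = (2/3) r_j / q^2.  Along Gamma x tends to 1/2, on the other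
  sheet to -1/2, and for even j P_j is odd: the coefficient of W is c^(1-j) P_j(1/2), whatever the path.

  The numbers P_j(1/2) follow from the Baecklund transformation between c - 1/(2 eta) and
  c + 1/(2 eta).  Its linearisation intertwines the two variational equations, so the difference of
  the two Riccati solutions is the t-derivative of the logarithm of an explicit series.  At x = 0 and
  x = 1/2 we have q = 0, all corrections to that series vanish, and eta^(-1) d/dc acts as
  the derivative with respect to z = c eta; the shift relation becomes
  2 sinh(X/2) b(X) = -X for b(X) = -1 + sum over even j >= 2 of P_j(1/2) X^j / (j-2)!,
  whence the Bernoulli numbers.
*)
theory Submission
  imports Defs "HOL-Complex_Analysis.Conformal_Mappings"
begin

unbundle no vec_syntax
unbundle fps_syntax

section \<open>Formal power series\<close>

text \<open>The turning point is x = infinity, where a nonconstant polynomial P_j has a pole; what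
  the loop contributes is only the exchange of x and -x between the sheets. The Baecklund
  transformation compares t-derivatives, so integrating it would leave an unknown function of c.
  Anchoring all antiderivatives at x = 0 removes this freedom, and the relation can be read off at x
  = 1/2. The leading term sqrt Delta has no antiderivative that is polynomial in x: even its first
  derivative in c integrates to a logarithm. The second one is the t-derivative of w times a
  polynomial with value -1 at x = 1/2. Hence the constant -1 in b, and hence order 1 is treated
  apart. The factor 1/(j-2)! is a Borel transform: z^(1-j) becomes X^(j-2)/(j-2)!, and d/dz becomes
  multiplication by -X; b carries a further X^2. Since the shifts by plus and minus 1/(2 eta) are
  symmetric, their difference contains only odd derivatives in c; in odd orders of w it sees only
  the r_j with even j, those of R_odd.\<close>

lemma fps_mult_nth_order:
  fixes f g :: "'a::comm_ring_1 fps"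
  assumes "\<And>i. i < n \<Longrightarrow> f $ i = 0"
  shows "(f * g) $ n = f $ n * g $ 0"
proof -
  have "(f * g) $ n = (\<Sum>i=0..n. f $ i * g $ (n - i))" by (rule fps_mult_nth)
  also have "\<dots> = (\<Sum>i\<in>{n}. f $ i * g $ (n - i))"
    by (rule sum.mono_neutral_right) (use assms in auto)
  finally show ?thesis by simp
qed

lemma fps_mult_nth_order_0:
  fixes f g :: "'a::comm_ring_1 fps"
  assumes "\<And>i. i < n \<Longrightarrow> f $ i = 0" "m < n"
  shows "(f * g) $ m = 0"
  using fps_mult_nth_order[of m f g] assms by simp

lemma fps_mult_nth_order_add:
  fixes f g :: "'a::comm_ring_1 fps"
  assumes "\<And>k. k < i \<Longrightarrow> f $ k = 0" "\<And>k. k < j \<Longrightarrow> g $ k = 0" "n < i + j"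
  shows "(f * g) $ n = 0"
  unfolding fps_mult_nth
proof (rule sum.neutral, rule ballI)
  fix k assume "k \<in> {0..n}"
  then have "k < i \<or> n - k < j" using assms(3) by auto
  then show "f $ k * g $ (n - k) = 0" using assms by auto
qed

lemma fps_mult_nth_cong:
  fixes f g f' g' :: "'a::comm_ring_1 fps"
  assumes "\<And>i. i \<le> n \<Longrightarrow> f $ i = f' $ i" "\<And>i. i \<le> n \<Longrightarrow> g $ i = g' $ i"
  shows "(f * g) $ n = (f' * g') $ n"
  unfolding fps_mult_nth by (rule sum.cong) (use assms in auto)

section \<open>Fixed points of contractive maps on formal power series\<close>

definition contractive :: "('a::zero fps \<Rightarrow> 'a fps) \<Rightarrow> bool" where
  "contractive F \<longleftrightarrow> (\<forall>n f g. (\<forall>i<n. f $ i = g $ i) \<longrightarrow> F f $ n = F g $ n)"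

definition fps_fixpoint :: "('a::zero fps \<Rightarrow> 'a fps) \<Rightarrow> 'a fps" where
  "fps_fixpoint F = Abs_fps (\<lambda>n. (F ^^ Suc n) 0 $ n)"

text \<open>Each application of \<open>F\<close> settles one more coefficient, so the iterates of
  \<open>0\<close> agree at index n from step n + 1 on, and the diagonal sequence is their
  limit.\<close>

lemma fps_fixpoint:
  assumes "contractive F"
  shows "F (fps_fixpoint F) = fps_fixpoint F"
proof -
  have c: "F f $ n = F g $ n" if "\<And>i. i < n \<Longrightarrow> f $ i = g $ i" for f g n
    using assms that unfolding contractive_def by blast
  have st: "(F ^^ Suc (n + k)) 0 $ n = (F ^^ Suc n) 0 $ n" for n k
  proof (induction n arbitrary: k rule: less_induct)
    case (less n)
    have "F ((F ^^ (n + k)) 0) $ n = F ((F ^^ n) 0) $ n"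
    proof (rule c)
      fix i assume i: "i < n"
      then obtain j where j: "n = Suc (i + j)" using less_iff_Suc_add by auto
      have "(F ^^ (n + k)) 0 $ i = (F ^^ Suc i) 0 $ i" using less[OF i, of "j + k"] j
        by (simp add: add.assoc)
      moreover have "(F ^^ n) 0 $ i = (F ^^ Suc i) 0 $ i" using less[OF i, of j] j by simp
      ultimately show "(F ^^ (n + k)) 0 $ i = (F ^^ n) 0 $ i" by simp
    qed
    then show ?case by simp
  qed
  show ?thesis
  proof (rule fps_ext)
    fix n
    have "F (fps_fixpoint F) $ n = F ((F ^^ n) 0) $ n"
    proof (rule c)
      fix i assume "i < n"
      then obtain j where j: "n = Suc (i + j)" using less_iff_Suc_add by auto
      show "fps_fixpoint F $ i = (F ^^ n) 0 $ i"
        using st[of i j] j by (simp add: fps_fixpoint_def)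
    qed
    then show "F (fps_fixpoint F) $ n = fps_fixpoint F $ n" by (simp add: fps_fixpoint_def)
  qed
qed

section \<open>The derivations with respect to t and c\<close>

text \<open>A series f of degree d stands for the formal function s^d f(x, w), where w = 1/(c eta) is the
  variable of the series and x = l/s that of its coefficients. In these coordinates dt d is
  eta^(-1) d/dt, which raises the degree to d + 1, and dc d is eta^(-1) d/dc at fixed t, with values
  again of degree d; note that c^(-1) = w eta and c = s^3 q(x).\<close>

type_synonym pser = "complex poly fps"

definition xx :: pser where "xx = fps_const [:0, 1:]"
definition hf :: pser where "hf = fps_const [:1/2:]"
definition ww :: pser where "ww = fps_X"
definition qp :: "complex poly" where "qp = [:0, -1, 0, 4:]"
definition qq :: pser where "qq = fps_const qp"
definition q1 :: pser where "q1 = 12 * xx^2 - 1"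
definition tt :: pser where "tt = 1 - 6 * xx^2"

definition dX :: "pser \<Rightarrow> pser" where "dX f = Abs_fps (\<lambda>n. pderiv (f $ n))"
definition dW :: "pser \<Rightarrow> pser" where "dW f = ww * fps_deriv f"

text \<open>Obtained from dx/dt = 3 q / (2 s^2), ds/dt = (1 - 12 x^2) / (2 s) and eta^(-1) = w s^3
  q; w does not depend on t.\<close>

definition dt :: "nat \<Rightarrow> pser \<Rightarrow> pser" where
  "dt d f = ww * (qq * (3 * hf * qq * dX f - of_nat d * hf * q1 * f))"

text \<open>Implicit differentiation at fixed t gives c dx/dc = q (6 x^2 - 1) and c ds/dc = -6 x q
  s. The term with \<open>dW\<close> is there because w = 1/(c eta) itself depends on c.\<close>

definition dc :: "nat \<Rightarrow> pser \<Rightarrow> pser" where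
  "dc d f = ww * (qq * ((6 * xx^2 - 1) * dX f - 6 * of_nat d * xx * f) - dW f)"

lemma hf2: "2 * hf = 1"
proof -
  have "2 * hf = fps_const ([:2:] * [:1/2:])"
    unfolding hf_def fps_const_mult[symmetric] by (simp add: numeral_fps_const numeral_poly)
  then show ?thesis by (simp add: one_pCons)
qed

lemma qq_eq: "qq = 4 * xx^3 - xx"
proof -
  have "4 * xx^3 - xx = fps_const ([:4:] * [:0,1:]^3 - [:0,1:])"
    unfolding xx_def fps_const_mult[symmetric] fps_const_sub[symmetric] fps_const_power[symmetric]
    by (simp add: numeral_fps_const numeral_poly)
  then show ?thesis by (simp add: qq_def qp_def power3_eq_cube)
qed

lemma dX_add [simp]: "dX (f + g) = dX f + dX g"
  by (rule fps_ext) (simp add: dX_def pderiv_add)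
lemma dX_diff [simp]: "dX (f - g) = dX f - dX g"
  by (rule fps_ext) (simp add: dX_def pderiv_diff)
lemma dX_minus [simp]: "dX (- f) = - dX f"
  by (rule fps_ext) (simp add: dX_def pderiv_minus)
lemma dX_0 [simp]: "dX 0 = 0"
  by (rule fps_ext) (simp add: dX_def)
lemma pderiv_sum: "pderiv (sum f A) = (\<Sum>i\<in>A. pderiv (f i))"
  by (induction A rule: infinite_finite_induct) (auto simp: pderiv_add)
lemma dX_mult [simp]: "dX (f * g) = dX f * g + f * dX g"
proof (rule fps_ext)
  fix n
  have "dX (f * g) $ n = (\<Sum>i=0..n. pderiv (f $ i) * g $ (n - i) + f $ i * pderiv (g $ (n - i)))"
    by (simp add: dX_def fps_mult_nth pderiv_sum pderiv_mult mult.commute add.commute)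
  also have "\<dots> = (dX f * g + f * dX g) $ n"
    by (simp add: dX_def fps_mult_nth sum.distrib)
  finally show "dX (f * g) $ n = (dX f * g + f * dX g) $ n" .
qed
lemma dX_1 [simp]: "dX 1 = 0"
  using dX_mult[of 1 1] by (simp del: dX_mult)
lemma dX_of_nat [simp]: "dX (of_nat n) = 0"
  by (induction n) simp_all
lemma dX_numeral [simp]: "dX (numeral n) = 0"
  using dX_of_nat[of "numeral n"] by (simp del: dX_of_nat)
lemma dX_power [simp]: "dX (f ^ n) = of_nat n * f ^ (n - 1) * dX f"
  by (induction n) (auto simp: algebra_simps power_eq_if)
lemma dX_xx [simp]: "dX xx = 1"
  by (rule fps_ext) (auto simp: dX_def xx_def pderiv_pCons fps_const_def one_pCons)
lemma dX_hf [simp]: "dX hf = 0"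
  by (rule fps_ext) (auto simp: dX_def hf_def pderiv_pCons fps_const_def)
lemma dX_ww [simp]: "dX ww = 0"
  by (rule fps_ext) (auto simp: dX_def ww_def fps_X_def)
lemma dX_qq [simp]: "dX qq = q1"
  by (simp add: qq_eq q1_def power2_eq_square)

lemma dW_add [simp]: "dW (f + g) = dW f + dW g"
  by (simp add: dW_def algebra_simps)
lemma dW_0 [simp]: "dW 0 = 0"
  by (simp add: dW_def)
lemma dW_minus [simp]: "dW (- f) = - dW f"
  by (simp add: dW_def)
lemma dW_diff [simp]: "dW (f - g) = dW f - dW g"
  by (simp add: dW_def algebra_simps)
lemma dW_mult [simp]: "dW (f * g) = dW f * g + f * dW g"
  by (simp add: dW_def algebra_simps)
lemma dW_1 [simp]: "dW 1 = 0"
  by (simp add: dW_def)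
lemma dW_of_nat [simp]: "dW (of_nat n) = 0"
  by (simp add: dW_def)
lemma dW_numeral [simp]: "dW (numeral n) = 0"
  by (simp add: dW_def)
lemma dW_power [simp]: "dW (f ^ n) = of_nat n * f ^ (n - 1) * dW f"
  by (induction n) (auto simp: algebra_simps power_eq_if)
lemma dW_xx [simp]: "dW xx = 0"
  by (simp add: dW_def xx_def)
lemma dW_hf [simp]: "dW hf = 0"
  by (simp add: dW_def hf_def)
lemma dW_ww [simp]: "dW ww = ww"
  by (simp add: dW_def ww_def)
lemma dW_qq [simp]: "dW qq = 0"
  by (simp add: dW_def qq_def)
lemma dW_nth: "dW f $ n = of_nat n * f $ n"
  by (cases n) (auto simp: dW_def ww_def)
lemma dX_nth: "dX f $ n = pderiv (f $ n)"
  by (simp add: dX_def)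
lemma dX_dW: "dX (dW f) = dW (dX f)"
  by (rule fps_ext) (simp add: dX_nth dW_nth pderiv_mult)

lemma dt_add: "dt d (f + g) = dt d f + dt d g"
  by (simp add: dt_def algebra_simps)
lemma dt_diff: "dt d (f - g) = dt d f - dt d g"
  by (simp add: dt_def algebra_simps)
lemma dt_minus: "dt d (- f) = - dt d f"
  by (simp add: dt_def algebra_simps)
lemma dt_0: "dt d 0 = 0"
  by (simp add: dt_def)
lemma dt_mult: "dt (d + e) (f * g) = dt d f * g + f * dt e g"
  by (simp add: dt_def algebra_simps)
lemma dc_add: "dc d (f + g) = dc d f + dc d g"
  by (simp add: dc_def algebra_simps)
lemma dc_0: "dc d 0 = 0"
  by (simp add: dc_def)
lemma dc_mult: "dc (d + e) (f * g) = dc d f * g + f * dc e g"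
  by (simp add: dc_def algebra_simps)

text \<open>Mixed partial derivatives in t and c commute; the degree is d + 1 where
  \<open>dc\<close> acts after \<open>dt\<close>.\<close>

lemma dt_dc: "dt d (dc d f) = dc (d + 1) (dt d f)"
proof -
  have q1: "dX q1 = 24 * xx" "dW q1 = 0" by (auto simp: q1_def)
  have a: "dX (dc d f) = ww * (q1 * ((6 * xx^2 - 1) * dX f - 6 * of_nat d * xx * f)
      + qq * ((6 * xx^2 - 1) * dX (dX f) + 12 * xx * dX f - 6 * of_nat d * f - 6 * of_nat d * xx * dX f)
      - dX (dW f))"
    unfolding dc_def by (simp only: dX_mult dX_diff dX_ww dX_qq dX_power dX_numeral dX_1 dX_xx dX_of_nat)
      (simp add: algebra_simps)
  have b: "dX (dt d f) = ww * (q1 * (3 * hf * qq * dX f - of_nat d * hf * q1 * f)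
      + qq * (3 * hf * q1 * dX f + 3 * hf * qq * dX (dX f) - of_nat d * hf * (24 * xx) * f
              - of_nat d * hf * q1 * dX f))"
    unfolding dt_def by (simp only: dX_mult dX_diff dX_ww dX_qq dX_numeral dX_hf q1 dX_of_nat)
      (simp add: algebra_simps)
  have c: "dW (dt d f) = dt d f + ww * (qq * (3 * hf * qq * dX (dW f) - of_nat d * hf * q1 * dW f))"
    unfolding dt_def by (simp only: dW_mult dW_diff dW_ww dW_qq dW_numeral dW_hf q1 dW_of_nat dX_dW)
      (simp add: algebra_simps)
  show ?thesis
    unfolding dt_def[of d "dc d f"] dc_def[of "d + 1" "dt d f"] a b c
    unfolding dc_def dt_def of_nat_add of_nat_1 q1_def qq_eq
    by (simp only: ring_distribs power2_eq_square power3_eq_cube mult_1_left mult_1_right)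
      (simp add: algebra_simps)
qed

text \<open>\<open>tt\<close>, \<open>qq\<close> and \<open>ww * qq\<close> represent t, c and
  eta^(-1) in degrees 2, 3 and 3. This and the next four identities are therefore the obvious
  derivatives of t, c and eta^(-1), multiplied by eta^(-1).\<close>

lemma dt_tt: "dt 2 tt = ww * qq"
  using hf2 unfolding dt_def tt_def q1_def qq_eq by (simp; algebra)
lemma dc_tt: "dc 2 tt = 0"
  unfolding dc_def tt_def by (simp; algebra)
lemma dc_qq: "dc 3 qq = ww * qq"
  unfolding dc_def by (simp add: q1_def qq_eq; algebra)
lemma dc_ww_qq: "dc 3 (ww * qq) = 0"
  unfolding dc_def by (simp add: q1_def qq_eq; algebra)
lemma dt_qq: "dt 3 qq = 0"
  unfolding dt_def by (simp add: algebra_simps)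

lemma dt_nth_0 [simp]: "dt d f $ 0 = 0"
  by (simp add: dt_def ww_def)
lemma dc_nth_0 [simp]: "dc d f $ 0 = 0"
  by (simp add: dc_def ww_def)

lemma dt_nth_Suc: "dt d f $ Suc n =
    qp * (smult (3/2) (qp * pderiv (f $ n)) - smult (of_nat d / 2) (pderiv qp * f $ n))"
proof -
  have *: "3 * hf * qq = fps_const (smult (3/2) qp)"
    "of_nat d * hf * q1 = fps_const (smult (of_nat d / 2) (pderiv qp))"
  proof -
    have a: "3 * hf = fps_const [:3/2:]" "of_nat d * hf = fps_const [:of_nat d / 2:]"
      unfolding hf_def by (simp_all add: numeral_fps_const numeral_poly fps_of_nat[symmetric] of_nat_poly)
    have "q1 = fps_const (pderiv qp)"
      using dX_qq unfolding qq_def dX_def by (auto simp: fps_eq_iff split: if_splits)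
    then have b: "q1 = fps_const (pderiv qp)" .
    show "3 * hf * qq = fps_const (smult (3/2) qp)"
      "of_nat d * hf * q1 = fps_const (smult (of_nat d / 2) (pderiv qp))"
      unfolding a b qq_def by simp_all
  qed
  show ?thesis unfolding dt_def * unfolding ww_def qq_def by (simp add: dX_nth)
qed

lemma dc_nth_Suc: "dc d f $ Suc n =
    qp * ([:-1, 0, 6:] * pderiv (f $ n) - smult (6 * of_nat d) ([:0,1:] * f $ n)) - of_nat n * f $ n"
proof -
  have *: "6 * xx^2 - 1 = fps_const [:-1, 0, 6:]"
    "6 * of_nat d * xx = fps_const (smult (6 * of_nat d) [:0,1:])"
    unfolding xx_def
    by (simp_all add: numeral_fps_const numeral_poly fps_of_nat[symmetric] of_nat_poly power2_eq_square
        one_pCons fps_const_1_eq_1[symmetric] del: fps_const_1_eq_1)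
  show ?thesis unfolding dc_def * unfolding ww_def qq_def by (simp add: dX_nth dW_nth)
qed

section \<open>Shifting the parameter c\<close>

definition divpow :: "complex \<Rightarrow> nat \<Rightarrow> nat \<Rightarrow> pser \<Rightarrow> pser" where
  "divpow \<kappa> d k f = fps_const [:\<kappa> ^ k / fact k:] * (dc d ^^ k) f"

text \<open>sh is exp(kappa eta^(-1) d/dc), the substitution of c + kappa/eta for c. It is well defined
  because dc raises the order in w.\<close>

definition sh :: "complex \<Rightarrow> nat \<Rightarrow> pser \<Rightarrow> pser" where
  "sh \<kappa> d f = Abs_fps (\<lambda>n. \<Sum>k\<le>n. divpow \<kappa> d k f $ n)"

lemma dc_order:
  assumes "\<And>i. i < n \<Longrightarrow> f $ i = 0" "i < Suc n"
  shows "dc d f $ i = 0"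
  using assms by (cases i) (auto simp: dc_nth_Suc)

lemma dc_pow_order: "n < k \<Longrightarrow> (dc d ^^ k) f $ n = 0"
proof (induction k arbitrary: n)
  case (Suc k)
  then show ?case by (auto intro!: dc_order[of k])
qed simp

lemma divpow_order: "n < k \<Longrightarrow> divpow \<kappa> d k f $ n = 0"
  by (simp add: divpow_def dc_pow_order)

lemma divpow_0 [simp]: "divpow \<kappa> d 0 f = f"
  by (simp add: divpow_def one_pCons[symmetric])

lemma sh_nth: "n \<le> N \<Longrightarrow> sh \<kappa> d f $ n = (\<Sum>k\<le>N. divpow \<kappa> d k f) $ n"
  unfolding sh_def fps_sum_nth fps_nth_Abs_fps
  by (rule sum.mono_neutral_left) (auto intro: divpow_order)

lemma sh_nth_0 [simp]: "sh \<kappa> d f $ 0 = f $ 0"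
  by (simp add: sh_def)

lemma dc_const: "dc d (fps_const [:a:] * f) = fps_const [:a:] * dc d f"
proof -
  have "dX (fps_const [:a:]) = 0" by (rule fps_ext) (auto simp: dX_def fps_const_def pderiv_pCons)
  moreover have "dW (fps_const [:a:]) = 0" by (simp add: dW_def)
  ultimately show ?thesis by (simp add: dc_def algebra_simps)
qed

lemma dt_const: "dt d (fps_const [:a:] * f) = fps_const [:a:] * dt d f"
proof -
  have "dX (fps_const [:a:]) = 0" by (rule fps_ext) (auto simp: dX_def fps_const_def pderiv_pCons)
  then show ?thesis by (simp add: dt_def algebra_simps)
qed

lemma dc_sum: "dc d (sum f A) = (\<Sum>i\<in>A. dc d (f i))"
  by (induction A rule: infinite_finite_induct) (auto simp: dc_add dc_0)
lemma dt_sum: "dt d (sum f A) = (\<Sum>i\<in>A. dt d (f i))"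
  by (induction A rule: infinite_finite_induct) (auto simp: dt_add dt_0)

lemma fps_const_of_nat_poly: "fps_const [:of_nat n:] = (of_nat n :: pser)"
  by (simp add: fps_of_nat[symmetric] of_nat_poly)

lemma divpow_Suc: "of_nat (Suc k) * divpow \<kappa> d (Suc k) f = fps_const [:\<kappa>:] * dc d (divpow \<kappa> d k f)"
proof -
  have "(of_nat (Suc k) :: complex) * (\<kappa> ^ Suc k / fact (Suc k)) = \<kappa> * (\<kappa> ^ k / fact k)"
    by (simp add: fact_Suc del: of_nat_Suc)
  then have "(of_nat (Suc k) :: pser) * fps_const [:\<kappa> ^ Suc k / fact (Suc k):]
      = fps_const [:\<kappa>:] * fps_const [:\<kappa> ^ k / fact k:]"
    unfolding fps_const_of_nat_poly[symmetric] fps_const_mult by simp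
  then show ?thesis
    unfolding divpow_def dc_const mult.assoc[symmetric] by simp
qed

lemma pser_of_nat_cancel:
  assumes "of_nat (Suc n) * f = (of_nat (Suc n) * g :: pser)"
  shows "f = g"
proof (rule fps_ext)
  fix m
  have "of_nat (Suc n) * f $ m = of_nat (Suc n) * g $ m"
    using arg_cong[OF assms, of "\<lambda>h. h $ m"]
    unfolding fps_of_nat[symmetric] fps_mult_left_const_nth .
  then show "f $ m = g $ m" by (metis mult_left_cancel of_nat_neq_0)
qed

text \<open>Leibniz rule without binomial coefficients. In the induction the factor
  \<open>Suc n\<close> is split as i + (Suc n - i), and each part is absorbed by
  \<open>divpow_Suc\<close> in one of the two factors.\<close>

lemma divpow_mult:
  "divpow \<kappa> (d + e) n (f * g) = (\<Sum>i\<le>n. divpow \<kappa> d i f * divpow \<kappa> e (n - i) g)"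
proof (induction n)
  case (Suc n)
  let ?F = "\<lambda>i. divpow \<kappa> d i f" and ?G = "\<lambda>i. divpow \<kappa> e i g"
  have "of_nat (Suc n) * (\<Sum>i\<le>Suc n. ?F i * ?G (Suc n - i))
      = (\<Sum>i\<le>Suc n. of_nat (i + (Suc n - i)) * (?F i * ?G (Suc n - i)))"
    unfolding sum_distrib_left by (intro sum.cong) auto
  also have "\<dots> = (\<Sum>i\<le>Suc n. of_nat i * ?F i * ?G (Suc n - i))
      + (\<Sum>i\<le>Suc n. ?F i * (of_nat (Suc n - i) * ?G (Suc n - i)))"
    unfolding sum.distrib[symmetric] of_nat_add by (intro sum.cong) (auto simp: algebra_simps)
  also have "(\<Sum>i\<le>Suc n. of_nat i * ?F i * ?G (Suc n - i))
      = (\<Sum>i\<le>n. (of_nat (Suc i) * ?F (Suc i)) * ?G (n - i))"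
    by (subst sum.atMost_Suc_shift) simp
  also have "(\<Sum>i\<le>Suc n. ?F i * (of_nat (Suc n - i) * ?G (Suc n - i)))
      = (\<Sum>i\<le>n. ?F i * (of_nat (Suc (n - i)) * ?G (Suc (n - i))))"
    by (subst sum.atMost_Suc) (auto intro!: sum.cong simp: Suc_diff_le simp del: of_nat_Suc)
  finally have "of_nat (Suc n) * (\<Sum>i\<le>Suc n. ?F i * ?G (Suc n - i))
      = fps_const [:\<kappa>:] * dc (d + e) (\<Sum>i\<le>n. ?F i * ?G (n - i))"
    unfolding divpow_Suc dc_sum dc_mult sum.distrib sum_distrib_left
    by (simp add: algebra_simps sum.distrib sum_distrib_left)
  also have "\<dots> = of_nat (Suc n) * divpow \<kappa> (d + e) (Suc n) (f * g)"
    unfolding divpow_Suc Suc.IH ..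
  finally show ?case using pser_of_nat_cancel by metis
qed simp

lemma sh_add: "sh \<kappa> d (f + g) = sh \<kappa> d f + sh \<kappa> d g"
proof -
  have "(dc d ^^ k) (f + g) = (dc d ^^ k) f + (dc d ^^ k) g" for k
    by (induction k) (auto simp: dc_add)
  then have "divpow \<kappa> d k (f + g) = divpow \<kappa> d k f + divpow \<kappa> d k g" for k
    by (simp add: divpow_def algebra_simps)
  then show ?thesis by (intro fps_ext) (simp add: sh_def sum.distrib)
qed

lemma sh_mult: "sh \<kappa> (d + e) (f * g) = sh \<kappa> d f * sh \<kappa> e g"
proof (rule fps_ext)
  fix n
  let ?F = "\<lambda>i. divpow \<kappa> d i f" and ?G = "\<lambda>i. divpow \<kappa> e i g"
  have "(sh \<kappa> d f * sh \<kappa> e g) $ n = ((\<Sum>i\<le>n. ?F i) * (\<Sum>j\<le>n. ?G j)) $ n"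
    by (rule fps_mult_nth_cong) (auto intro: sh_nth)
  also have "\<dots> = (\<Sum>(i,j)\<in>{..n}\<times>{..n}. (?F i * ?G j) $ n)"
    by (simp add: sum_product sum.cartesian_product fps_sum_nth split_beta)
  \<comment> \<open>A product of terms i and j has order at least i + j in w, so pairs with i + j >
    n do not contribute.\<close>
  also have "\<dots> = (\<Sum>(i,j)\<in>{(i,j). i + j \<le> n}. (?F i * ?G j) $ n)"
    by (rule sum.mono_neutral_right)
       (auto intro!: fps_mult_nth_order_add divpow_order)
  also have "\<dots> = (\<Sum>k\<le>n. \<Sum>i\<le>k. (?F i * ?G (k - i)) $ n)"
    by (rule sum.triangle_reindex_eq)
  also have "\<dots> = sh \<kappa> (d + e) (f * g) $ n"
    by (simp add: sh_def divpow_mult fps_sum_nth)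
  finally show "sh \<kappa> (d + e) (f * g) $ n = (sh \<kappa> d f * sh \<kappa> e g) $ n" ..
qed

lemma dt_cong:
  assumes "\<And>i. i < n \<Longrightarrow> f $ i = g $ i"
  shows "dt d f $ n = dt d g $ n"
  using assms by (cases n) (auto simp: dt_nth_Suc)

lemma dt_sh: "dt d (sh \<kappa> d f) = sh \<kappa> (d + 1) (dt d f)"
proof (rule fps_ext)
  fix n
  have c: "dt d ((dc d ^^ k) f) = (dc (d + 1) ^^ k) (dt d f)" for k
    by (induction k) (auto simp: dt_dc[simplified])
  have "dt d (sh \<kappa> d f) $ n = dt d (\<Sum>k\<le>n. divpow \<kappa> d k f) $ n"
    by (rule dt_cong) (simp add: sh_nth)
  also have "\<dots> = sh \<kappa> (d + 1) (dt d f) $ n"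
    unfolding dt_sum by (subst sh_nth[of n n]) (simp_all add: divpow_def dt_const c)
  finally show "dt d (sh \<kappa> d f) $ n = sh \<kappa> (d + 1) (dt d f) $ n" .
qed

lemma divpow_1: "divpow \<kappa> d 1 f = fps_const [:\<kappa>:] * dc d f"
  by (simp add: divpow_def)

lemma sh_1: assumes "dc d f = 0" shows "sh \<kappa> d f = f"
proof -
  have "(dc d ^^ k) f = 0" if k: "k > 0" for k
  proof -
    obtain j where "k = Suc j" using k by (cases k) auto
    moreover have "(dc d ^^ j) 0 = 0" by (induction j) (auto simp: dc_0)
    ultimately show ?thesis using assms by (simp only: funpow_Suc_right o_apply)
  qed
  then have *: "divpow \<kappa> d k f = 0" if "k > 0" for k using that by (simp add: divpow_def)
  show ?thesis
  proof (rule fps_ext)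
    fix n
    have "sh \<kappa> d f $ n = (\<Sum>k\<in>{0}. divpow \<kappa> d k f $ n)"
      unfolding sh_def fps_nth_Abs_fps by (rule sum.mono_neutral_right) (auto simp: *)
    then show "sh \<kappa> d f $ n = f $ n" by simp
  qed
qed

lemma sh_tt: "sh \<kappa> 2 tt = tt"
  by (rule sh_1) (rule dc_tt)

text \<open>The Taylor expansion of c + \<kappa>/eta stops after the linear term, because eta^(-1),
  which is \<open>ww * qq\<close>, does not depend on c.\<close>

lemma sh_qq: "sh \<kappa> 3 qq = qq + fps_const [:\<kappa>:] * (ww * qq)"
proof -
  have "(dc 3 ^^ Suc (Suc k)) qq = 0" for k
    by (induction k) (simp_all add: dc_qq dc_ww_qq dc_0)
  then have *: "divpow \<kappa> 3 (Suc (Suc k)) qq = 0" for k by (simp add: divpow_def)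
  have **: "divpow \<kappa> 3 k qq = 0" if "k \<noteq> 0" "k \<noteq> 1" for k
    using *[of "k - 2"] that by (cases k rule: nat.exhaust) (auto simp: Suc_diff_Suc numeral_2_eq_2)
  show ?thesis
  proof (rule fps_ext)
    fix n
    \<comment> \<open>The bound \<open>Suc n\<close> instead of n keeps the linear term k = 1 in the
      sum even for n = 0.\<close>
    have "sh \<kappa> 3 qq $ n = (\<Sum>k\<le>Suc n. divpow \<kappa> 3 k qq) $ n" by (rule sh_nth) simp
    also have "(\<Sum>k\<le>Suc n. divpow \<kappa> 3 k qq) = (\<Sum>k\<in>{0,1}. divpow \<kappa> 3 k qq)"
      by (rule sum.mono_neutral_right) (auto intro: **)
    also have "\<dots> = qq + fps_const [:\<kappa>:] * (ww * qq)" by (simp add: divpow_1[simplified] dc_qq)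
    finally show "sh \<kappa> 3 qq $ n = (qq + fps_const [:\<kappa>:] * (ww * qq)) $ n" .
  qed
qed

section \<open>The universal formal solutions\<close>

lemma contractiveI:
  assumes "\<And>n f g. (\<And>i. i < n \<Longrightarrow> f $ i = g $ i) \<Longrightarrow> F f $ n = F g $ n"
  shows "contractive F"
  using assms unfolding contractive_def by blast

definition tail :: "'a::comm_ring_1 fps \<Rightarrow> 'a fps" where "tail f = f - fps_const (f $ 0)"

text \<open>In the factorised difference of squares the first factor vanishes below order n and the
  second has no constant term, so nothing is left at order n.\<close>

lemma tail_sq_cong:
  assumes "\<And>i. i < n \<Longrightarrow> f $ i = g $ i"
  shows "(tail f ^ 2) $ n = (tail g ^ 2) $ n"
proof (cases "n = 0")
  case True
  then show ?thesis by (simp add: tail_def power2_eq_square)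
next
  case False
  have "((tail f - tail g) * (tail f + tail g)) $ n = (tail f - tail g) $ n * (tail f + tail g) $ 0"
    by (rule fps_mult_nth_order) (use assms False in \<open>auto simp: tail_def fps_const_def\<close>)
  also have "(tail f + tail g) $ 0 = 0" by (simp add: tail_def)
  also have "(tail f - tail g) * (tail f + tail g) = tail f ^ 2 - tail g ^ 2"
    by (simp add: algebra_simps power2_eq_square)
  finally show ?thesis by simp
qed

lemma tail_cube_cong:
  assumes "\<And>i. i < n \<Longrightarrow> f $ i = g $ i"
  shows "(tail f ^ 3) $ n = (tail g ^ 3) $ n"
proof (cases "n = 0")
  case True
  then show ?thesis by (simp add: tail_def power3_eq_cube)
next
  case False
  have "((tail f - tail g) * (tail f ^ 2 + tail f * tail g + tail g ^ 2)) $ n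
      = (tail f - tail g) $ n * (tail f ^ 2 + tail f * tail g + tail g ^ 2) $ 0"
    by (rule fps_mult_nth_order) (use assms False in \<open>auto simp: tail_def fps_const_def\<close>)
  also have "(tail f ^ 2 + tail f * tail g + tail g ^ 2) $ 0 = 0"
    by (simp add: tail_def power2_eq_square)
  also have "(tail f - tail g) * (tail f ^ 2 + tail f * tail g + tail g ^ 2) = tail f ^ 3 - tail g ^ 3"
    by (simp add: algebra_simps power2_eq_square power3_eq_cube)
  finally show ?thesis by simp
qed

text \<open>PII solved for v = Lam - x: the linear part 6x^2 + (1 - 6x^2) is 1. The constant term
  of v is removed from the nonlinear part to make the map contractive on all series.\<close>

definition LamF :: "pser \<Rightarrow> pser" where
  "LamF v = dt 2 (dt 1 (xx + v)) - fps_const [:0, 6:] * tail v ^ 2 - fps_const [:2:] * tail v ^ 3"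

definition Lam :: pser where "Lam = xx + fps_fixpoint LamF"

lemma contractive_LamF: "contractive LamF"
proof (rule contractiveI)
  fix n and f g :: pser assume *: "\<And>i. i < n \<Longrightarrow> f $ i = g $ i"
  have "dt 2 (dt 1 (xx + f)) $ n = dt 2 (dt 1 (xx + g)) $ n"
    by (intro dt_cong) (simp add: *)
  then show "LamF f $ n = LamF g $ n"
    unfolding LamF_def
    by (simp add: tail_sq_cong[of n f g] tail_cube_cong[of n f g] *)
qed

lemma Lam_0: "Lam $ 0 = [:0, 1:]"
proof -
  have "fps_fixpoint LamF $ 0 = LamF (fps_fixpoint LamF) $ 0"
    by (simp add: fps_fixpoint[OF contractive_LamF])
  then show ?thesis by (simp add: LamF_def Lam_def tail_def power2_eq_square power3_eq_cube xx_def)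
qed

lemma Lam_PII: "dt 2 (dt 1 Lam) = 2 * Lam ^ 3 + tt * Lam + qq"
proof -
  define v where "v = fps_fixpoint LamF"
  have "LamF v = v" unfolding v_def by (rule fps_fixpoint[OF contractive_LamF])
  \<comment> \<open>The fixed point has no constant term, so removing it in \<open>LamF\<close>
    changed nothing and the true equation is recovered.\<close>
  moreover have "tail v = v" using Lam_0 by (simp add: Lam_def tail_def v_def[symmetric] xx_def)
  moreover have "fps_const [:0, 6:] = 6 * xx" "fps_const [:2:] = (2 :: pser)"
    by (simp_all add: xx_def numeral_fps_const numeral_poly)
  ultimately have "v = dt 2 (dt 1 Lam) - 6 * xx * v ^ 2 - 2 * v ^ 3"
    by (simp add: LamF_def Lam_def v_def[symmetric])
  then have "dt 2 (dt 1 Lam) = v + 6 * xx * v ^ 2 + 2 * v ^ 3" by (simp add: algebra_simps)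
  then show ?thesis unfolding Lam_def v_def[symmetric] tt_def qq_eq
    by (simp add: algebra_simps power2_eq_square power3_eq_cube)
qed

text \<open>The Riccati equation for y = R - 1, solved for its linear part 2 y: since t is 1 - 6 x^2
  in degree 2, the right side is 1 + 6 (Lam^2 - x^2).\<close>

definition RicF :: "pser \<Rightarrow> pser" where
  "RicF y = hf * (6 * (Lam ^ 2 - xx ^ 2) - dt 1 (1 + y) - tail y ^ 2)"

definition Ric :: pser where "Ric = 1 + fps_fixpoint RicF"

lemma contractive_RicF: "contractive RicF"
proof (rule contractiveI)
  fix n and f g :: pser assume *: "\<And>i. i < n \<Longrightarrow> f $ i = g $ i"
  have "dt 1 (1 + f) $ n = dt 1 (1 + g) $ n" by (intro dt_cong) (simp add: *)
  then show "RicF f $ n = RicF g $ n"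
    unfolding RicF_def hf_def by (simp add: tail_sq_cong[of n f g] *)
qed

lemma Ric_0: "Ric $ 0 = 1"
proof -
  have "fps_fixpoint RicF $ 0 = RicF (fps_fixpoint RicF) $ 0"
    by (simp add: fps_fixpoint[OF contractive_RicF])
  then show ?thesis
    by (simp add: RicF_def Ric_def tail_def power2_eq_square xx_def Lam_0 hf_def)
qed

lemma Ric_Riccati: "Ric ^ 2 + dt 1 Ric = 6 * Lam ^ 2 + tt"
proof -
  define y where "y = fps_fixpoint RicF"
  have "RicF y = y" unfolding y_def by (rule fps_fixpoint[OF contractive_RicF])
  moreover have "tail y = y" using Ric_0 by (simp add: Ric_def tail_def y_def[symmetric])
  ultimately have "hf * (6 * (Lam ^ 2 - xx ^ 2) - dt 1 Ric - y ^ 2) = y"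
    by (simp add: RicF_def Ric_def y_def[symmetric])
  then have "2 * y = (2 * hf) * (6 * (Lam ^ 2 - xx ^ 2) - dt 1 Ric - y ^ 2)" by (metis mult.assoc)
  then have "dt 1 Ric = 6 * (Lam ^ 2 - xx ^ 2) - y ^ 2 - 2 * y" unfolding hf2 by simp
  moreover have "Ric ^ 2 = 1 + 2 * y + y ^ 2"
    unfolding Ric_def y_def[symmetric] by (simp add: power2_eq_square algebra_simps)
  ultimately show ?thesis unfolding tt_def by (simp add: algebra_simps)
qed

lemma nat_add_numerals: "1 + 1 = (2::nat)" "1 + 2 = (3::nat)" "2 + 1 = (3::nat)"
  by simp_all

lemmas sh_mult_11 = sh_mult[of _ 1 1, unfolded nat_add_numerals]
lemmas sh_mult_12 = sh_mult[of _ 1 2, unfolded nat_add_numerals]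
lemmas sh_mult_21 = sh_mult[of _ 2 1, unfolded nat_add_numerals]
lemmas dt_sh_1 = dt_sh[of 1, unfolded nat_add_numerals]
lemmas dt_sh_2 = dt_sh[of 2, unfolded nat_add_numerals]

lemma sh_PII: "dt 2 (dt 1 (sh \<kappa> 1 Lam)) =
    2 * sh \<kappa> 1 Lam ^ 3 + tt * sh \<kappa> 1 Lam + qq + fps_const [:\<kappa>:] * (ww * qq)"
proof -
  have "dt 2 (dt 1 (sh \<kappa> 1 Lam)) = sh \<kappa> 3 (dt 2 (dt 1 Lam))"
    unfolding dt_sh_1 dt_sh_2 ..
  \<comment> \<open>Numerical factors are spelt out as repeated sums, for which additivity of
    \<open>sh\<close> suffices.\<close>
  also have "dt 2 (dt 1 Lam) = (Lam * (Lam * Lam) + Lam * (Lam * Lam)) + tt * Lam + qq"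
    unfolding Lam_PII by (simp add: power3_eq_cube algebra_simps)
  finally show ?thesis
    unfolding sh_add sh_qq sh_mult_12[of \<kappa> Lam "Lam * Lam"] sh_mult_11
      sh_mult_21[of \<kappa> tt] sh_tt
    by (simp add: power3_eq_cube algebra_simps)
qed

lemma sh_Riccati: "sh \<kappa> 1 Ric ^ 2 + dt 1 (sh \<kappa> 1 Ric) = 6 * sh \<kappa> 1 Lam ^ 2 + tt"
proof -
  have "sh \<kappa> 2 (Ric * Ric + dt 1 Ric)
      = sh \<kappa> 2 (Lam * Lam + Lam * Lam + Lam * Lam + Lam * Lam + Lam * Lam + Lam * Lam + tt)"
    using Ric_Riccati by (simp add: power2_eq_square)
  then show ?thesis
    unfolding sh_add sh_mult_11 sh_tt dt_sh_1[symmetric] by (simp add: power2_eq_square)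
qed

section \<open>Divisibility by powers of q and parity\<close>

lemma fps_fixpoint_invariant:
  assumes "\<And>n. Q n 0" "\<And>f n. (\<And>n. Q n (f $ n)) \<Longrightarrow> Q n (F f $ n)"
  shows "Q n (fps_fixpoint F $ n)"
proof -
  have "Q n ((F ^^ k) 0 $ n)" for k n
    by (induction k arbitrary: n) (auto intro: assms)
  then show ?thesis unfolding fps_fixpoint_def fps_nth_Abs_fps by blast
qed

definition qreg :: "pser \<Rightarrow> bool" where "qreg f \<longleftrightarrow> (\<forall>n. qp ^ n dvd f $ n)"

lemma qreg_const [simp]: "qreg (fps_const p)"
  by (auto simp: qreg_def)
lemma qreg_basic [simp]: "qreg 0" "qreg 1" "qreg (numeral k)" "qreg xx" "qreg hf" "qreg tt"
proof -
  show "qreg 0" "qreg xx" "qreg hf" unfolding xx_def hf_def fps_const_0_eq_0[symmetric] by (simp_all del: fps_const_0_eq_0)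
  show "qreg 1" unfolding fps_const_1_eq_1[symmetric] by (simp del: fps_const_1_eq_1)
  show "qreg (numeral k)" unfolding numeral_fps_const by simp
  have "tt = fps_const (1 - 6 * [:0,1:]^2)"
    unfolding tt_def xx_def by (simp add: numeral_fps_const)
  then show "qreg tt" by (metis qreg_const)
qed
lemma qreg_add: "qreg f \<Longrightarrow> qreg g \<Longrightarrow> qreg (f + g)"
  by (auto simp: qreg_def)
lemma qreg_diff: "qreg f \<Longrightarrow> qreg g \<Longrightarrow> qreg (f - g)"
  by (auto simp: qreg_def)
lemma qreg_mult: assumes "qreg f" "qreg g" shows "qreg (f * g)"
  unfolding qreg_def fps_mult_nth
proof (intro allI dvd_sum)
  fix n i :: nat assume "i \<in> {0..n}"
  then have "qp ^ n = qp ^ i * qp ^ (n - i)" by (simp add: power_add[symmetric])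
  then show "qp ^ n dvd f $ i * g $ (n - i)" using assms by (simp add: qreg_def mult_dvd_mono)
qed
lemma qreg_power: "qreg f \<Longrightarrow> qreg (f ^ k)"
  by (induction k) (auto intro: qreg_mult)
lemma qreg_tail: "qreg f \<Longrightarrow> qreg (tail f)"
  unfolding tail_def by (intro qreg_diff qreg_const)

lemma qp_mult_pderiv_power:
  "qp * pderiv (qp ^ n * g) = qp ^ n * (qp * pderiv g + of_nat n * (pderiv qp * g))"
proof (cases n)
  case (Suc m)
  then show ?thesis unfolding Suc pderiv_mult pderiv_power_Suc
    by (simp add: algebra_simps of_nat_poly smult_add_left)
qed simp

text \<open>The prefactor q of \<open>dt\<close> pays for the order gained, and q d/dx, unlike d/dx
  alone, preserves multiples of q^n.\<close>

lemma qreg_dt: assumes "qreg f" shows "qreg (dt d f)"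
  unfolding qreg_def
proof
  fix n
  show "qp ^ n dvd dt d f $ n"
  proof (cases n)
    case (Suc m)
    obtain g where g: "f $ m = qp ^ m * g" using assms unfolding qreg_def by (meson dvd_def)
    have "qp ^ m dvd smult (3/2) (qp * pderiv (f $ m)) - smult (of_nat d / 2) (pderiv qp * f $ m)"
      unfolding g qp_mult_pderiv_power by (intro dvd_diff dvd_smult dvd_triv_left dvd_mult)
    then show ?thesis unfolding Suc dt_nth_Suc power_Suc by (rule mult_dvd_mono[OF dvd_refl])
  qed simp
qed

text \<open>Here only one q is available, and the derivative uses it up. The missing power comes
  from a cancellation: on q^m the terms with d/dx and \<open>dW\<close> combine to the factor m ((6
  x^2 - 1) q' - 1), which equals 18 m x q.\<close>

lemma qreg_dc: assumes "qreg f" shows "qreg (dc d f)"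
  unfolding qreg_def
proof
  fix n
  show "qp ^ n dvd dc d f $ n"
  proof (cases n)
    case (Suc m)
    obtain g where g: "f $ m = qp ^ m * g" using assms unfolding qreg_def by (meson dvd_def)
    have e: "[:-1, 0, 6:] * pderiv qp - 1 = [:0, 18:] * qp"
      by (simp add: qp_def pderiv_pCons one_pCons)
    have "dc d f $ n = [:-1, 0, 6:] * (qp * pderiv (f $ m)) - qp * smult (6 * of_nat d) ([:0,1:] * f $ m) - of_nat m * f $ m"
      unfolding Suc dc_nth_Suc by (simp add: algebra_simps)
    also have "\<dots> = qp ^ m * (qp * ([:-1, 0, 6:] * pderiv g - smult (6 * of_nat d) ([:0,1:] * g))
         + of_nat m * ([:-1, 0, 6:] * pderiv qp - 1) * g)"
      unfolding g qp_mult_pderiv_power by (simp add: algebra_simps)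
    also have "\<dots> = qp ^ n * ([:-1, 0, 6:] * pderiv g - smult (6 * of_nat d) ([:0,1:] * g)
         + of_nat m * [:0,18:] * g)"
      unfolding e Suc by (simp add: algebra_simps)
    finally show ?thesis by simp
  qed simp
qed

lemma qreg_sh: assumes "qreg f" shows "qreg (sh \<kappa> d f)"
proof -
  have "qreg ((dc d ^^ k) f)" for k by (induction k) (auto intro: assms qreg_dc)
  then have "qreg (divpow \<kappa> d k f)" for k unfolding divpow_def by (intro qreg_mult) auto
  then show ?thesis unfolding qreg_def sh_def by (auto intro!: dvd_sum)
qed

lemma qreg_Lam: "qreg Lam"
proof -
  have "qreg (LamF f)" if "qreg f" for f
    unfolding LamF_def using that
    by (intro qreg_diff qreg_dt qreg_mult qreg_add qreg_power qreg_tail) simp_all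
  then have "qreg (fps_fixpoint LamF)"
    using fps_fixpoint_invariant[where Q = "\<lambda>n p. qp ^ n dvd p" and F = LamF]
    unfolding qreg_def by blast
  then show ?thesis unfolding Lam_def by (intro qreg_add) simp_all
qed

lemma qreg_Ric: "qreg Ric"
proof -
  have "qreg (RicF f)" if "qreg f" for f
    unfolding RicF_def using that qreg_Lam
    by (intro qreg_diff qreg_dt qreg_mult qreg_add qreg_power qreg_tail) simp_all
  then have "qreg (fps_fixpoint RicF)"
    using fps_fixpoint_invariant[where Q = "\<lambda>n p. qp ^ n dvd p" and F = RicF]
    unfolding qreg_def by blast
  then show ?thesis unfolding Ric_def by (intro qreg_add) simp_all
qed

definition rfl :: "complex poly \<Rightarrow> complex poly" where "rfl p = pcompose p [:0, -1:]"

text \<open>The parity reflects s to -s at fixed l and c, under which q, and hence q^n in the n-th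
  coefficient, is odd.\<close>

definition par :: "nat \<Rightarrow> pser \<Rightarrow> bool" where
  "par e f \<longleftrightarrow> (\<forall>n. rfl (f $ n) = smult ((-1) ^ (n + e)) (f $ n))"

lemma rfl_simps [simp]:
  "rfl 0 = 0" "rfl (p + r) = rfl p + rfl r" "rfl (p - r) = rfl p - rfl r" "rfl (- p) = - rfl p"
  "rfl (p * r) = rfl p * rfl r" "rfl (smult a p) = smult a (rfl p)" "rfl qp = - qp"
  by (simp_all add: rfl_def pcompose_add pcompose_diff pcompose_uminus pcompose_mult pcompose_smult
      qp_def pcompose_pCons)

lemma smult_sum_right: "smult a (sum f A) = (\<Sum>i\<in>A. smult a (f i))"
  by (induction A rule: infinite_finite_induct) (auto simp: smult_add_right)

lemma rfl_pderiv: "rfl (pderiv p) = - pderiv (rfl p)"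
  by (simp add: rfl_def pderiv_pcompose pderiv_pCons)

lemma par_add: "par e f \<Longrightarrow> par e g \<Longrightarrow> par e (f + g)"
  by (auto simp: par_def smult_add_right)
lemma par_diff: "par e f \<Longrightarrow> par e g \<Longrightarrow> par e (f - g)"
  by (auto simp: par_def smult_diff_right)
lemma par_mult: assumes "par e f" "par e' g" shows "par (e + e') (f * g)"
  unfolding par_def fps_mult_nth
proof
  fix n
  have rs: "rfl (sum h A) = (\<Sum>i\<in>A. rfl (h i))" for h and A :: "nat set"
    by (induction A rule: infinite_finite_induct) auto
  have "rfl (f $ i * g $ (n - i)) = smult ((- 1) ^ (n + (e + e'))) (f $ i * g $ (n - i))"
    if "i \<in> {0..n}" for i
  proof -
    have "(-1::complex) ^ (n + (e + e')) = (-1) ^ ((i + e) + (n - i + e'))"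
      using that by (simp add: algebra_simps)
    then show ?thesis using assms unfolding par_def by (simp add: power_add mult_ac)
  qed
  then show "rfl (\<Sum>i = 0..n. f $ i * g $ (n - i))
      = smult ((- 1) ^ (n + (e + e'))) (\<Sum>i = 0..n. f $ i * g $ (n - i))"
    unfolding rs by (simp add: smult_sum_right)
qed

lemma par_const: "rfl p = smult ((-1) ^ e) p \<Longrightarrow> par e (fps_const p)"
  by (auto simp: par_def fps_const_def)
lemma par_dt: assumes "par e f" shows "par e (dt d f)"
  unfolding par_def
proof
  fix n
  show "rfl (dt d f $ n) = smult ((-1) ^ (n + e)) (dt d f $ n)"
  proof (cases n)
    case (Suc m)
    have f: "rfl (f $ m) = smult ((-1) ^ (m + e)) (f $ m)" using assms by (simp add: par_def)
    have "rfl (pderiv qp) = pderiv qp" by (simp add: rfl_pderiv pderiv_minus)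
    then show ?thesis unfolding Suc dt_nth_Suc
      by (simp add: rfl_pderiv f pderiv_smult algebra_simps smult_diff_right smult_add_right)
  qed simp
qed

lemma par_Suc_Suc: "par (Suc (Suc e)) f = par e f"
  by (simp add: par_def)

lemma par_tail: assumes "par e f" shows "par e (tail f)"
  using assms by (auto simp: par_def tail_def fps_const_def)

lemma par_xx: "par 1 xx"
  unfolding xx_def by (rule par_const) (simp add: rfl_def pcompose_pCons)
lemma par_0_const: "par 0 (fps_const [:a:])"
  by (rule par_const) (simp add: rfl_def pcompose_pCons)

lemma par_Lam: "par 1 Lam"
proof -
  have "par 1 (LamF f)" if f: "par 1 f" for f
  proof -
    have "par 1 (dt 2 (dt 1 (xx + f)))" by (intro par_dt par_add par_xx f)
    moreover have "par (1 + (1 + 1)) (fps_const [:0, 6:] * (tail f * tail f))"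
      by (intro par_mult par_tail f par_const) (simp add: rfl_def pcompose_pCons)
    moreover have "par (0 + (1 + (1 + 1))) (fps_const [:2:] * (tail f * (tail f * tail f)))"
      by (intro par_mult par_tail f par_0_const)
    ultimately show ?thesis unfolding LamF_def power2_eq_square power3_eq_cube mult.assoc
      by (intro par_diff) (simp_all add: par_Suc_Suc)
  qed
  then have "par 1 (fps_fixpoint LamF)"
    using fps_fixpoint_invariant[where Q = "\<lambda>n p. rfl p = smult ((-1) ^ (n + 1)) p" and F = LamF]
    unfolding par_def by simp
  then show ?thesis unfolding Lam_def by (intro par_add par_xx)
qed

lemma par_Ric: "par 0 Ric"
proof -
  have 1: "par 0 1" using par_0_const[of 1] by (simp add: one_pCons[symmetric])
  have "par 0 (RicF f)" if f: "par 0 f" for f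
  proof -
    have "par (1 + 1) (Lam * Lam)" "par (1 + 1) (xx * xx)"
      by (intro par_mult par_Lam par_xx)+
    then have "par 0 (Lam * Lam)" "par 0 (xx * xx)" by (simp_all add: par_Suc_Suc)
    then have "par (0 + 0) (fps_const [:6:] * (Lam * Lam - xx * xx))"
      by (intro par_mult par_diff par_0_const)
    moreover have "fps_const [:6:] = (6 :: pser)" by (simp add: numeral_fps_const numeral_poly)
    ultimately have a: "par 0 (6 * (Lam * Lam - xx * xx))" by simp
    have "par (0 + 0) (tail f * tail f)" by (intro par_mult par_tail f)
    then have b: "par 0 (tail f * tail f)" by simp
    have "par (0 + 0) (RicF f)" unfolding RicF_def hf_def power2_eq_square
      by (intro par_mult par_0_const par_diff a b par_dt par_add 1 f)
    then show ?thesis by simp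
  qed
  then have "par 0 (fps_fixpoint RicF)"
    using fps_fixpoint_invariant[where Q = "\<lambda>n p. rfl p = smult ((-1) ^ (n + 0)) p" and F = RicF]
    unfolding par_def by simp
  then show ?thesis unfolding Ric_def by (intro par_add 1)
qed

lemma Lam_1: "Lam $ 1 = 0"
proof -
  have "fps_fixpoint LamF $ 1 = LamF (fps_fixpoint LamF) $ 1"
    by (simp add: fps_fixpoint[OF contractive_LamF])
  also have "\<dots> = 0"
    unfolding LamF_def One_nat_def
    by (simp add: dt_nth_Suc[of _ _ 0] tail_def power2_eq_square power3_eq_cube fps_mult_nth)
  finally show ?thesis by (simp add: Lam_def xx_def)
qed

section \<open>The Baecklund transformation\<close>

text \<open>lm and lp are lambda at c - 1/(2 eta) and c + 1/(2 eta). Both pp and pp' satisfy the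
  Painleve XXXIV equation, which involves c only through c^2, so they agree; this is the
  Baecklund transformation.\<close>

definition lm :: pser where "lm = sh (-1/2) 1 Lam"
definition lp :: pser where "lp = sh (1/2) 1 Lam"
definition rm :: pser where "rm = sh (-1/2) 1 Ric"
definition rp :: pser where "rp = sh (1/2) 1 Ric"
definition pp :: pser where "pp = dt 1 lm + lm ^ 2 + hf * tt"
definition pp' :: pser where "pp' = - dt 1 lp + lp ^ 2 + hf * tt"

lemma dt_mult_11: "dt 2 (f * g) = dt 1 f * g + f * dt 1 g"
  using dt_mult[of 1 1 f g] by (simp only: nat_add_numerals)
lemma dt_mult_12: "dt 3 (f * g) = dt 1 f * g + f * dt 2 g"
  using dt_mult[of 1 2 f g] by (simp only: nat_add_numerals)
lemma dt_mult_22: "dt 4 (f * g) = dt 2 f * g + f * dt 2 g"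
  using dt_mult[of 2 2 f g] by simp
lemma dt_mult_31: "dt 4 (f * g) = dt 3 f * g + f * dt 1 g"
  using dt_mult[of 3 1 f g] by simp
lemma dt_mult_14: "dt 5 (f * g) = dt 1 f * g + f * dt 4 g"
  using dt_mult[of 1 4 f g] by simp
lemma dt_hf: "dt d (hf * f) = hf * dt d f"
  unfolding hf_def by (rule dt_const)
lemma dt_2: "dt d (2 * f) = 2 * dt d f"
  unfolding mult_2 dt_add ..

lemma fps_const_half: "fps_const [:1/2:] = hf" "fps_const [:-1/2:] = - hf"
  by (simp_all add: hf_def)

lemma dt_pp: "dt 2 pp = 2 * lm * pp + qq"
proof -
  have "dt 2 (dt 1 lm) = 2 * lm ^ 3 + tt * lm + qq - hf * (ww * qq)"
    using sh_PII[of "-1/2"] unfolding lm_def[symmetric] fps_const_half by simp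
  then have "dt 2 pp = 2 * lm ^ 3 + (2 * hf) * (tt * lm) + qq + 2 * lm * dt 1 lm"
    unfolding pp_def dt_add power2_eq_square dt_mult_11 dt_hf dt_tt hf2 by simp
  then show ?thesis unfolding pp_def by (simp add: algebra_simps power2_eq_square power3_eq_cube)
qed

lemma dt_pp': "dt 2 pp' = - (2 * lp * pp' + qq)"
proof -
  have "dt 2 (dt 1 lp) = 2 * lp ^ 3 + tt * lp + qq + hf * (ww * qq)"
    using sh_PII[of "1/2"] unfolding lp_def[symmetric] fps_const_half by simp
  then have "dt 2 pp' = - 2 * lp ^ 3 - (2 * hf) * (tt * lp) - qq + 2 * lp * dt 1 lp"
    unfolding pp'_def dt_add dt_minus power2_eq_square dt_mult_11 dt_hf dt_tt hf2 by simp
  then show ?thesis unfolding pp'_def by (simp add: algebra_simps power2_eq_square power3_eq_cube)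
qed

lemma P34:
  assumes "dt 1 l = p - l ^ 2 - hf * tt" "dt 2 p = 2 * l * p + c" "dt 3 c = 0"
  shows "2 * p * dt 3 (dt 2 p) - dt 2 p ^ 2 = 4 * p ^ 3 - 2 * tt * p ^ 2 - c ^ 2"
proof -
  have "dt 3 (dt 2 p) = 2 * (dt 1 l * p + l * dt 2 p)"
    unfolding assms(2) dt_add assms(3) mult.assoc dt_2 dt_mult_12 by simp
  then show ?thesis using assms(1,2) hf2 by algebra
qed

lemma dt_order:
  assumes "\<And>i. i < n \<Longrightarrow> f $ i = 0" "i < Suc n"
  shows "dt d f $ i = 0"
  using assms by (cases i) (auto simp: dt_nth_Suc)

text \<open>The difference of two solutions satisfies a linear equation whose derivative terms are
  of higher order in w. At each order only the undifferentiated term remains, with factor the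
  derivative of 4 p^3 - 2 t p^2 at the common leading coefficient; the last assumption keeps it
  nonzero.\<close>

lemma P34_unique:
  assumes "2 * p * dt 3 (dt 2 p) - dt 2 p ^ 2 = 4 * p ^ 3 - 2 * tt * p ^ 2 - c"
    and "2 * r * dt 3 (dt 2 r) - dt 2 r ^ 2 = 4 * r ^ 3 - 2 * tt * r ^ 2 - c"
    and "p $ 0 = r $ 0" "12 * (r $ 0) ^ 2 - 4 * (tt $ 0 * r $ 0) \<noteq> 0"
  shows "p = r"
proof -
  define e where "e = p - r"
  have de: "dt 2 p = dt 2 r + dt 2 e" unfolding e_def by (simp add: dt_diff)
  have dde: "dt 3 (dt 2 p) = dt 3 (dt 2 r) + dt 3 (dt 2 e)" unfolding de dt_add ..
  have p: "p = r + e" by (simp add: e_def)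
  have E: "e * (4 * (p ^ 2 + p * r + r ^ 2) - 2 * tt * (p + r))
      = dt 3 (dt 2 e) * (2 * p) + e * (2 * dt 3 (dt 2 r)) - dt 2 e * (dt 2 p + dt 2 r)"
    using assms(1,2) unfolding dde unfolding de unfolding p
    by algebra
  have "e $ n = 0" for n
  proof (induction n rule: less_induct)
    case (less n)
    then have l: "\<And>i. i < n \<Longrightarrow> e $ i = 0" by blast
    have l2: "\<And>i. i < Suc n \<Longrightarrow> dt 2 e $ i = 0" using l dt_order by blast
    have l3: "\<And>i. i < Suc n \<Longrightarrow> dt 3 (dt 2 e) $ i = 0" using l2 dt_order less_SucI by blast
    have "(dt 3 (dt 2 e) * (2 * p)) $ n = 0"
      by (rule fps_mult_nth_order_0[of "Suc n"]) (auto intro: l3)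
    moreover have "(e * (2 * dt 3 (dt 2 r))) $ n = 0"
      by (subst fps_mult_nth_order) (auto intro: l)
    moreover have "(dt 2 e * (dt 2 p + dt 2 r)) $ n = 0"
      by (rule fps_mult_nth_order_0[of "Suc n"]) (auto intro: l2)
    ultimately have "(e * (4 * (p ^ 2 + p * r + r ^ 2) - 2 * tt * (p + r))) $ n = 0"
      unfolding E by simp
    then have "e $ n * (4 * (p ^ 2 + p * r + r ^ 2) - 2 * tt * (p + r)) $ 0 = 0"
      by (subst (asm) fps_mult_nth_order) (auto intro: l)
    moreover have "(4 * (p ^ 2 + p * r + r ^ 2) - 2 * tt * (p + r)) $ 0 = 12 * (r $ 0) ^ 2 - 4 * (tt $ 0 * r $ 0)"
      using assms(3) by (simp add: power2_eq_square numeral_fps_const)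
    ultimately show ?case using assms(4) by auto
  qed
  then have "e = 0" by (intro fps_ext) simp
  then show ?thesis by (simp add: e_def)
qed

lemma tt_0: "tt $ 0 = [:1, 0, -6:]"
  by (simp add: tt_def xx_def power2_eq_square one_pCons numeral_fps_const numeral_poly)
lemma lm_0: "lm $ 0 = [:0, 1:]" and lp_0: "lp $ 0 = [:0, 1:]"
  by (simp_all add: lm_def lp_def Lam_0)
lemma rm_0: "rm $ 0 = 1" and rp_0: "rp $ 0 = 1"
  by (simp_all add: rm_def rp_def Ric_0)
lemma pp_0: "pp $ 0 = [:1/2, 0, -2:]" and pp'_0: "pp' $ 0 = [:1/2, 0, -2:]"
  by (simp_all add: pp_def pp'_def lm_0 lp_0 hf_def tt_0 power2_eq_square)

lemma pp'_eq: "pp' = pp"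
proof (rule P34_unique)
  show "2 * pp * dt 3 (dt 2 pp) - dt 2 pp ^ 2 = 4 * pp ^ 3 - 2 * tt * pp ^ 2 - qq ^ 2"
    by (rule P34[of lm]) (simp_all add: dt_pp dt_qq, simp add: pp_def)
  have "2 * pp' * dt 3 (dt 2 pp') - dt 2 pp' ^ 2 = 4 * pp' ^ 3 - 2 * tt * pp' ^ 2 - (- qq) ^ 2"
    by (rule P34[of "- lp"]) (simp_all add: dt_pp' dt_qq dt_minus, simp add: pp'_def)
  then show "2 * pp' * dt 3 (dt 2 pp') - dt 2 pp' ^ 2 = 4 * pp' ^ 3 - 2 * tt * pp' ^ 2 - qq ^ 2" by simp
  show "12 * (pp $ 0) ^ 2 - 4 * (tt $ 0 * pp $ 0) \<noteq> 0"
    unfolding pp_0 tt_0 by (simp add: power2_eq_square numeral_poly)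
qed (simp add: pp_0 pp'_0)

lemma two_cancel: "2 * f = 0 \<Longrightarrow> f = (0 :: pser)"
  by simp

text \<open>The derivative of \<open>pp\<close> has one expression through \<open>lm\<close> and one
  through \<open>lp\<close>; equating them leaves an algebraic relation without derivatives.\<close>

lemma lp_pp: "lp * pp + lm * pp + qq = 0"
proof -
  have "2 * (lp * pp + lm * pp + qq) = 0"
    using dt_pp dt_pp' unfolding pp'_eq by (simp add: algebra_simps)
  then show ?thesis by (rule two_cancel)
qed

text \<open>AA and BB multiply the variations of lm and lp to give the variation of pp. As
  lp = - lm - c/pp, the ratio of these variations is MM/pp^2.\<close>

definition AA :: pser where "AA = rm + 2 * lm"
definition BB :: pser where "BB = 2 * lp - rp"
definition MM :: pser where "MM = qq * AA - pp ^ 2"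

lemma dt_AA: "dt 1 AA = 2 * pp - AA ^ 2 + 4 * lm * AA"
proof -
  have "dt 1 AA = dt 1 rm + 2 * dt 1 lm" unfolding AA_def dt_add dt_2 ..
  moreover have "rm ^ 2 + dt 1 rm = 6 * lm ^ 2 + tt" unfolding rm_def lm_def by (rule sh_Riccati)
  ultimately show ?thesis using hf2 unfolding pp_def AA_def by algebra
qed

lemma dt_BB: "dt 1 BB = BB ^ 2 - 4 * lp * BB - 2 * pp"
proof -
  have "dt 1 BB = 2 * dt 1 lp - dt 1 rp" unfolding BB_def dt_diff dt_2 ..
  moreover have "rp ^ 2 + dt 1 rp = 6 * lp ^ 2 + tt" unfolding rp_def lp_def by (rule sh_Riccati)
  ultimately show ?thesis using hf2 unfolding pp'_eq[symmetric] pp'_def BB_def by algebra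
qed

lemma dt_MM: "dt 4 MM = 4 * lm * MM - qq * AA ^ 2"
proof -
  have "dt 4 MM = qq * dt 1 AA - 2 * pp * dt 2 pp"
    unfolding MM_def power2_eq_square dt_diff dt_mult_31[of qq] dt_mult_22[of pp] dt_qq by simp
  then show ?thesis unfolding dt_AA dt_pp MM_def by algebra
qed

text \<open>Because \<open>dt\<close> raises the order in w, the lowest coefficient of
  \<open>e\<close> would be annihilated by the nonzero \<open>g $ 0\<close>.\<close>

lemma dt_eigen_zero:
  assumes "dt d e = g * e" "g $ 0 \<noteq> 0"
  shows "e = 0"
proof -
  have "e $ n = 0" for n
  proof (induction n rule: less_induct)
    case (less n)
    then have l: "\<And>i. i < n \<Longrightarrow> e $ i = 0" by blast
    have "dt d e $ n = 0" by (rule dt_order[of n]) (use l in auto)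
    then have "(e * g) $ n = 0" unfolding assms(1) by (simp add: mult.commute)
    then have "e $ n * g $ 0 = 0" by (subst (asm) fps_mult_nth_order) (use l in auto)
    then show ?case using assms(2) by simp
  qed
  then show ?thesis by (intro fps_ext) simp
qed

text \<open>A variation phi of \<open>lm\<close> with logarithmic derivative \<open>rm\<close>
  changes \<open>pp\<close> by \<open>AA\<close> phi and \<open>lp\<close> by (MM/pp^2) phi; if
  \<open>BB\<close> measures the effect of the latter on \<open>pp\<close>, both must agree. The
  defect satisfies a homogeneous linear equation whose coefficient has constant term -2, hence
  vanishes.\<close>

lemma BB_MM: "BB * MM = AA * pp ^ 2"
proof -
  define e where "e = BB * MM - AA * pp ^ 2"
  have "dt 5 e = dt 1 BB * MM + BB * dt 4 MM - (dt 1 AA * pp ^ 2 + AA * (2 * pp * dt 2 pp))"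
    unfolding e_def dt_diff dt_mult_14 power2_eq_square dt_mult_22 by (simp add: algebra_simps)
  then have "dt 5 e = (BB - AA - 4 * lp + 4 * lm) * e"
    using lp_pp unfolding dt_BB dt_AA dt_MM dt_pp e_def unfolding MM_def by algebra
  moreover have "(BB - AA - 4 * lp + 4 * lm) $ 0 \<noteq> 0"
    unfolding BB_def AA_def by (simp add: lm_0 lp_0 rm_0 rp_0 numeral_fps_const numeral_poly one_pCons)
  ultimately have "e = 0" by (rule dt_eigen_zero)
  then show ?thesis by (simp add: e_def)
qed

text \<open>The logarithmic derivatives of corresponding variations of \<open>lp\<close> and
  \<open>lm\<close> differ by that of their ratio MM/pp^2; denominators are cleared here.\<close>

lemma shift_log_derivative: "MM * pp * (rp - rm) = dt 4 MM * pp - 2 * dt 2 pp * MM"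
proof -
  have "rp = 2 * lp - BB" "rm = AA - 2 * lm" by (simp_all add: BB_def AA_def)
  then show ?thesis
    using BB_MM lp_pp unfolding dt_MM dt_pp unfolding MM_def by algebra
qed

section \<open>The shift of R is exact up to an explicit term\<close>

definition prim :: "complex poly \<Rightarrow> complex poly" where
  "prim p = (\<Sum>i\<le>degree p. monom (coeff p i / of_nat (Suc i)) (Suc i))"

lemma pderiv_prim: "pderiv (prim p) = p"
proof -
  have "pderiv (prim p) = (\<Sum>i\<le>degree p. monom (coeff p i) i)"
    unfolding prim_def pderiv_sum by (intro sum.cong refl) (simp add: pderiv_monom del: of_nat_Suc)
  then show ?thesis by (simp add: poly_as_sum_of_monoms)
qed

lemma poly_prim_0 [simp]: "poly (prim p) 0 = 0"
  by (simp add: prim_def poly_sum poly_monom)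

lemma poly_eqI_pderiv:
  fixes p r :: "complex poly"
  assumes "pderiv p = pderiv r" "poly p a = poly r a"
  shows "p = r"
proof -
  have "pderiv (p - r) = 0" using assms(1) by (simp add: pderiv_diff)
  then have "degree (p - r) = 0" by (simp add: pderiv_eq_0_iff)
  then obtain b where b: "p - r = [:b:]" by (rule degree_eq_zeroE)
  have "poly (p - r) a = b" unfolding b by simp
  then have "b = 0" using assms(2) by simp
  then show ?thesis using b by simp
qed

section \<open>Evaluation at the zeros of q and vanishing Wronskians\<close>

definition evx :: "complex \<Rightarrow> pser \<Rightarrow> complex fps" where "evx a f = Abs_fps (\<lambda>n. poly (f $ n) a)"

lemma evx_simps [simp]:
  "evx a (f + g) = evx a f + evx a g" "evx a (f - g) = evx a f - evx a g" "evx a (- f) = - evx a f"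
  "evx a 0 = 0" "evx a 1 = 1" "evx a (f * g) = evx a f * evx a g"
  "evx a (fps_const p) = fps_const (poly p a)"
  by (auto simp: evx_def fps_eq_iff fps_mult_nth poly_sum fps_const_def)
lemma evx_dW: "evx a (dW f) = fps_X * fps_deriv (evx a f)"
proof (rule fps_ext)
  fix n show "evx a (dW f) $ n = (fps_X * fps_deriv (evx a f)) $ n"
    by (cases n) (auto simp: evx_def dW_nth)
qed
lemma evx_basic: "evx a xx = fps_const a" "evx a hf = fps_const (1/2)" "evx a 2 = 2"
proof -
  show "evx a xx = fps_const a" "evx a hf = fps_const (1/2)" by (simp_all add: xx_def hf_def)
  show "evx a 2 = 2" using evx_simps(1)[of a 1 1] by simp
qed

lemma evx_qreg:
  assumes "qreg f" "poly qp a = 0"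
  shows "evx a f = fps_const (poly (f $ 0) a)"
proof (rule fps_ext)
  fix n
  show "evx a f $ n = fps_const (poly (f $ 0) a) $ n"
  proof (cases n)
    case (Suc m)
    obtain g where "f $ n = qp ^ n * g" using assms(1) unfolding qreg_def by (meson dvd_def)
    then show ?thesis using assms(2) Suc by (simp add: evx_def)
  qed (simp add: evx_def)
qed

text \<open>A vanishing Wronskian makes g a multiple of l. Orders at 0 show this without quotients:
  if g were nonzero, l g' would have order one less than g, whereas l' g has at least the order of
  g.\<close>

lemma poly_wronskian_zero:
  fixes l g :: "complex poly"
  assumes "l * pderiv g = pderiv l * g" "poly g 0 = 0" "poly l 0 \<noteq> 0"
  shows "g = 0"
proof (rule ccontr)
  assume g: "g \<noteq> 0"
  have pg: "pderiv g \<noteq> 0"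
    using poly_eqI_pderiv[of g 0 0] assms(2) g by auto
  have l: "l \<noteq> 0" using assms(3) by auto
  have o: "order 0 g = Suc (order 0 (pderiv g))" by (rule order_pderiv[OF g assms(2)])
  have n: "l * pderiv g \<noteq> 0" using l pg by simp
  then have n': "pderiv l * g \<noteq> 0" using assms(1) by simp
  have "order 0 (l * pderiv g) = order 0 (pderiv g)"
    using order_mult[OF n, of 0] assms(3) order_root[of l 0] by simp
  moreover have "order 0 (pderiv l * g) \<ge> order 0 g" using order_mult[OF n', of 0] by simp
  ultimately show False using assms(1) o by simp
qed

lemma fps_wronskian_zero:
  assumes "L * dX J = dX L * J" "evx 0 J = 0" "poly (L $ 0) 0 \<noteq> 0"
  shows "J = 0"
proof -
  have "J $ n = 0" for n
  proof (induction n rule: less_induct)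
    case (less n)
    then have l: "\<And>i. i < n \<Longrightarrow> J $ i = 0" by blast
    have "(dX J * L) $ n = dX J $ n * L $ 0"
      by (rule fps_mult_nth_order) (simp add: dX_nth l)
    moreover have "(J * dX L) $ n = J $ n * dX L $ 0"
      by (rule fps_mult_nth_order) (simp add: l)
    ultimately have "L $ 0 * pderiv (J $ n) = pderiv (L $ 0) * J $ n"
      using assms(1) by (metis dX_nth mult.commute)
    moreover have "poly (J $ n) 0 = 0"
      using arg_cong[OF assms(2), of "\<lambda>f. f $ n"] by (simp add: evx_def)
    ultimately show ?case using assms(3) by (rule poly_wronskian_zero)
  qed
  then show ?thesis by (intro fps_ext) simp
qed

text \<open>\<open>qq\<close>, \<open>pp\<close> and \<open>MM\<close> all vanish at x = 1/2. This
  common factor is split off so that the cofactors of \<open>pp\<close> and \<open>MM\<close> are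
  nonzero there.\<close>

definition vv :: pser where "vv = 1 - 4 * xx ^ 2"

lemma qq_vv: "qq = - xx * vv"
  by (simp add: qq_eq vv_def algebra_simps power2_eq_square power3_eq_cube)

lemma vv_const: "vv = fps_const [:1, 0, -4:]"
proof -
  have "vv = fps_const (1 - 4 * [:0,1:]^2)"
    unfolding vv_def xx_def by (simp add: numeral_fps_const)
  then show ?thesis by (simp add: power2_eq_square numeral_poly one_pCons)
qed

lemma vv_nonzero: "vv \<noteq> 0"
  unfolding vv_const by simp

lemma dX_vv: "dX vv = - 8 * xx"
  by (simp add: vv_def)

text \<open>For n at least 2, \<open>pp $ n\<close> has two factors q, and one survives the division
  by \<open>vv\<close>. At n = 1 there is only one, so the cofactor is trivial at the zeros of q
  only because this coefficient vanishes.\<close>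

lemma pp_1: "pp $ 1 = 0"
proof -
  have lm1: "lm $ 1 = smult (1/2) qp"
    unfolding lm_def sh_def One_nat_def
    by (simp add: Lam_1[simplified] divpow_def dc_nth_Suc Lam_0 pderiv_pCons qp_def)
  have "dt 1 lm $ 1 = - ([:0,1:] * qp)"
    unfolding One_nat_def dt_nth_Suc lm_0 by (simp add: qp_def pderiv_pCons)
  moreover have "(lm ^ 2) $ 1 = [:0,1:] * qp"
    unfolding power2_eq_square One_nat_def
    by (simp add: fps_mult_nth lm1[simplified] lm_0 qp_def)
  moreover have "(hf * tt) $ 1 = 0"
    by (simp add: hf_def tt_def xx_def numeral_fps_const power2_eq_square)
  ultimately show ?thesis by (simp add: pp_def)
qed

lemma qreg_lm: "qreg lm" and qreg_rm: "qreg rm" and qreg_rp: "qreg rp"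
  unfolding lm_def rm_def rp_def by (intro qreg_sh qreg_Lam qreg_Ric)+

lemma qreg_pp: "qreg pp"
  unfolding pp_def by (intro qreg_add qreg_dt qreg_power qreg_mult qreg_lm) simp_all

lemma pp_factor:
  obtains u where "pp = hf * (vv * u)" "u $ 0 = 1"
    "\<And>a. poly qp a = 0 \<Longrightarrow> evx a u = 1"
proof -
  have "\<exists>g. pp $ n = [:1/2, 0, -2:] * g \<and> (if n = 0 then g = 1 else qp dvd g)" for n
  proof (cases "n \<ge> 2")
    case True
    then have "qp ^ 2 dvd pp $ n" using qreg_pp unfolding qreg_def by (meson dvd_trans le_imp_power_dvd)
    then obtain h where "pp $ n = qp ^ 2 * h" by (elim dvdE)
    moreover have qv: "qp = [:1/2, 0, -2:] * [:0, -2:]" by (simp add: qp_def)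
    have "qp * (qp * h) = ([:1/2, 0, -2:] * [:0, -2:]) * (qp * h)" by (simp only: qv[symmetric])
    ultimately have "pp $ n = ([:1/2, 0, -2:] * [:0, -2:]) * (qp * h)"
      by (simp only: power2_eq_square mult.assoc)
    then have "pp $ n = [:1/2, 0, -2:] * (qp * ([:0, -2:] * h))" by (simp only: mult_ac)
    moreover have "qp dvd qp * ([:0, -2:] * h)" by (rule dvd_triv_left)
    moreover have "n \<noteq> 0" using True by simp
    ultimately show ?thesis by metis
  next
    case False
    then have "n = 0 \<or> n = 1" by auto
    then show ?thesis
    proof
      assume "n = 0" then show ?thesis by (intro exI[of _ 1]) (simp add: pp_0)
    next
      assume "n = 1" then show ?thesis by (intro exI[of _ 0]) (use pp_1 in simp)
    qed
  qed
  then obtain u where u: "\<And>n. pp $ n = [:1/2, 0, -2:] * u n"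
    "\<And>n. if n = 0 then u n = 1 else qp dvd u n" by metis
  define U where "U = Abs_fps u"
  have hv: "hf * vv = fps_const [:1/2, 0, -2:]" unfolding hf_def vv_const by simp
  have "pp = hf * vv * U"
    unfolding hv U_def by (rule fps_ext) (simp add: u(1))
  moreover have "U $ 0 = 1" using u(2)[of 0] by (simp add: U_def)
  moreover have "evx a U = 1" if "poly qp a = 0" for a
  proof (rule fps_ext)
    fix n
    show "evx a U $ n = 1 $ n"
    proof (cases "n = 0")
      case False
      then obtain h where "u n = qp * h" using u(2)[of n] by (auto elim: dvdE)
      then show ?thesis using that False by (simp add: evx_def U_def)
    qed (use u(2)[of 0] in \<open>simp add: evx_def U_def\<close>)
  qed
  ultimately show thesis using that[of U] by (simp add: mult.assoc)
qed

lemma rp_minus_rm_low: "(rp - rm) $ 0 = 0" "(rp - rm) $ 1 = - 6 * [:0,1:] * qp"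
proof -
  show "(rp - rm) $ 0 = 0" by (simp add: rp_0 rm_0)
  have "(rp - rm) $ 1 = smult (1/2) (dc 1 Ric $ 1) + smult (1/2) (dc 1 Ric $ 1)"
    unfolding rp_def rm_def sh_def One_nat_def by (simp add: divpow_def)
  also have "\<dots> = dc 1 Ric $ 1" by (simp add: smult_add_left[symmetric])
  finally show "(rp - rm) $ 1 = - 6 * [:0,1:] * qp"
    unfolding One_nat_def dc_nth_Suc by (simp add: Ric_0 qp_def numeral_poly)
qed

lemma dt_0_nth_Suc: "dt 0 f $ Suc n = smult (3/2) (qp ^ 2 * pderiv (f $ n))"
  by (simp add: dt_nth_Suc power2_eq_square mult.assoc)

text \<open>From order 2 on the coefficients are divisible by q^2 and have polynomial
  antiderivatives. The coefficient of w contains a single q, its antiderivative is a logarithm, and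
  so it is kept as a separate term.\<close>

lemma rp_minus_rm_exact:
  obtains \<Gamma> where "rp - rm = - 6 * (ww * (xx * qq)) + dt 0 \<Gamma>"
    "evx 0 \<Gamma> = 0" "\<Gamma> $ 0 = 0"
proof -
  define \<Gamma> where "\<Gamma> = Abs_fps (\<lambda>n. if n = 0 then 0 else prim (smult (2/3) ((rp - rm) $ Suc n div qp ^ 2)))"
  have "(rp - rm) $ n = (- 6 * (ww * (xx * qq)) + dt 0 \<Gamma>) $ n" for n
  proof -
    have w: "(- 6 * (ww * (xx * qq))) $ n = (if n = 1 then - 6 * [:0,1:] * qp else 0)"
    proof -
      have "- 6 * (ww * (xx * qq)) = fps_X * fps_const (- 6 * [:0,1:] * qp)"
        by (simp add: ww_def xx_def qq_def numeral_fps_const algebra_simps)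
      then show ?thesis by simp
    qed
    consider "n = 0" | "n = 1" | m where "n = Suc m" "m \<noteq> 0" by (metis One_nat_def not0_implies_Suc)
    then show ?thesis
    proof cases
      case 1 then show ?thesis using rp_minus_rm_low w by simp
    next
      case 2 then show ?thesis using rp_minus_rm_low w by (simp add: dt_0_nth_Suc \<Gamma>_def)
    next
      case 3
      have "qreg (rp - rm)" by (intro qreg_diff qreg_rp qreg_rm)
      moreover have "2 \<le> n" using 3 by simp
      ultimately have "qp ^ 2 dvd (rp - rm) $ n" unfolding qreg_def by (meson dvd_trans le_imp_power_dvd)
      then have "(rp - rm) $ n = qp ^ 2 * ((rp - rm) $ n div qp ^ 2)" by simp
      then show ?thesis unfolding fps_add_nth w
        using 3 by (simp add: dt_0_nth_Suc \<Gamma>_def pderiv_prim)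
    qed
  qed
  then have "rp - rm = - 6 * (ww * (xx * qq)) + dt 0 \<Gamma>" by (rule fps_ext)
  moreover have "evx 0 \<Gamma> = 0" by (rule fps_ext) (simp add: evx_def \<Gamma>_def)
  moreover have "\<Gamma> $ 0 = 0" by (simp add: \<Gamma>_def)
  ultimately show thesis by (rule that)
qed

lemma dt_0_eq: "dt 0 f = ww * (qq * (3 * hf * qq * dX f))"
  by (simp add: dt_def)

text \<open>With MM = vv Y and pp = vv u / 2, the series dX Gamma is the logarithmic x-derivative of
  Y/u^2 apart from its w-independent part. Applying w d/dw to the logarithm removes that part and
  avoids the logarithm itself: J = 0 states that w d/dw of log(Y/u^2) - Gamma vanishes.\<close>

lemma exact_part_vanishes:
  assumes G: "rp - rm = - 6 * (ww * (xx * qq)) + dt 0 \<Gamma>" "evx 0 \<Gamma> = 0" "\<Gamma> $ 0 = 0"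
  shows "evx (1/2) \<Gamma> = 0"
proof -
  obtain u where u: "pp = hf * (vv * u)" "u $ 0 = 1" "\<And>a. poly qp a = 0 \<Longrightarrow> evx a u = 1"
    by (rule pp_factor) blast
  define Y where "Y = - xx * AA - hf * hf * (vv * u ^ 2)"
  define L where "L = u * Y"
  define N where "N = dX \<Gamma> * L - u * dX Y + 2 * dX u * Y"
  have q0: "poly qp 0 = 0" and q2: "poly qp (1/2) = 0" by (simp_all add: qp_def)
  have M: "MM = vv * Y"
    unfolding MM_def Y_def u(1) qq_vv by (simp add: algebra_simps power2_eq_square)
  have "dt 4 MM * pp - 2 * dt 2 pp * MM = 3 * hf * (ww * (qq * qq * (dX MM * pp - 2 * dX pp * MM)))"
    unfolding dt_def by (simp add: algebra_simps)
  also have "dX MM * pp - 2 * dX pp * MM = hf * vv * (8 * xx * L + vv * (u * dX Y - 2 * dX u * Y))"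
    unfolding M u(1) L_def dX_mult dX_vv dX_hf by (simp add: algebra_simps)
  finally have "vv * Y * (hf * (vv * u)) * (- 6 * (ww * (xx * qq)) + dt 0 \<Gamma>)
      = 3 * hf * (ww * (qq * qq * (hf * vv * (8 * xx * L + vv * (u * dX Y - 2 * dX u * Y)))))"
    using shift_log_derivative unfolding G(1)[symmetric] M[symmetric] u(1)[symmetric] by simp
  then have e: "(3 * (hf * hf) * ww * vv ^ 3 * xx ^ 2) *
     (2 * L * 2 + vv * dX \<Gamma> * L - (8 * xx * L + vv * (u * dX Y - 2 * dX u * Y))) = 0"
    unfolding dt_0_eq qq_vv L_def using hf2 by algebra
  have "3 * (hf * hf) * ww * vv ^ 3 * xx ^ 2 \<noteq> 0"
    using vv_nonzero hf2 by (auto simp: ww_def xx_def)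
  with e have "2 * L * 2 + vv * dX \<Gamma> * L - (8 * xx * L + vv * (u * dX Y - 2 * dX u * Y)) = 0"
    by (metis mult_eq_0_iff)
  \<comment> \<open>Divided by \<open>L\<close>, \<open>N\<close> is the x-derivative of \<Gamma> -
    log(Y/u^2); by this equation the quotient is -4/(1 + 2 x), which is free of w.\<close>
  then have k: "vv * N = (8 * xx - 4) * L"
    unfolding N_def by (simp add: algebra_simps)
  have "vv * dW N = (8 * xx - 4) * dW L"
    using arg_cong[OF k, of dW] by (simp add: vv_def)
  with k have "vv * (L * dW N - dW L * N) = 0" by algebra
  then have k2: "L * dW N = dW L * N" using vv_nonzero by simp
  define J where "J = u * dW Y - 2 * Y * dW u - L * dW \<Gamma>"
  have "L * dX J = dX L * J"
    using k2 unfolding J_def N_def L_def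
    by (simp add: dX_dW) algebra
  moreover have A: "evx a AA = fps_const (1 + 2 * a)" if "poly qp a = 0" for a
  proof -
    have "evx a AA = evx a rm + (evx a lm + evx a lm)" unfolding AA_def mult_2 evx_simps ..
    also have "\<dots> = fps_const (1 + 2 * a)"
      unfolding evx_qreg[OF qreg_rm that] evx_qreg[OF qreg_lm that] rm_0 lm_0 fps_const_add by simp
    finally show ?thesis .
  qed
  \<comment> \<open>The value is -1/4 at a = 0 and -1 at a = 1/2. The first starts the Wronskian
    argument, the second lets \<open>dW\<close> of \<Gamma> be read off from J = 0.\<close>
  have Y: "evx a Y = fps_const (- a * (1 + 2 * a) - (1/4) * (1 - 4 * a ^ 2))" if "poly qp a = 0" for a
    unfolding Y_def power2_eq_square vv_const evx_simps A[OF that] u(3)[OF that] evx_basic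
    by (simp add: algebra_simps)
  have dWu: "evx a (dW u) = 0" if "poly qp a = 0" for a
    unfolding evx_dW u(3)[OF that] by simp
  have dWY: "evx a (dW Y) = 0" if "poly qp a = 0" for a
    unfolding evx_dW Y[OF that] by simp
  have "evx 0 J = 0"
    unfolding J_def evx_simps dWu[OF q0] dWY[OF q0] unfolding evx_dW G(2) by simp
  moreover have "poly (L $ 0) 0 \<noteq> 0"
  proof -
    have "evx 0 L = fps_const (-1/4)" unfolding L_def evx_simps u(3)[OF q0] Y[OF q0] by simp
    then have "evx 0 L $ 0 = -1/4" by simp
    then show ?thesis by (simp add: evx_def)
  qed
  ultimately have "J = 0" using fps_wronskian_zero by blast
  then have "0 = evx (1/2) J" by simp
  also have "\<dots> = - (evx (1/2) L * evx (1/2) (dW \<Gamma>))"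
    unfolding J_def evx_simps dWu[OF q2] dWY[OF q2] by simp
  also have "evx (1/2) L = -1"
    unfolding L_def evx_simps u(3)[OF q2] Y[OF q2] by (simp add: power2_eq_square fps_const_neg[symmetric] del: fps_const_neg)
  finally have z: "fps_X * fps_deriv (evx (1/2) \<Gamma>) = 0" by (simp add: evx_dW)
  show ?thesis
  proof (rule fps_ext)
    fix n
    show "evx (1/2) \<Gamma> $ n = 0 $ n"
    proof (cases n)
      case 0 then show ?thesis using G(3) by (simp add: evx_def)
    next
      case (Suc m)
      have "fps_deriv (evx (1/2) \<Gamma>) = 0" using z by simp
      then have "of_nat (Suc m) * evx (1/2) \<Gamma> $ Suc m = 0"
        by (metis Suc_eq_plus1 fps_deriv_nth fps_zero_nth)
      then show ?thesis using Suc by (simp del: of_nat_Suc)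
    qed
  qed
qed

section \<open>The recursion for the Voros coefficients\<close>

lemma dc_pow_cong:
  assumes "f $ n = g $ n"
  shows "(dc d ^^ k) f $ (n + k) = (dc d ^^ k) g $ (n + k)"
  by (induction k) (simp_all add: assms dc_nth_Suc)

text \<open>At a zero of q only the part - w \<open>dW\<close> of \<open>dc\<close> survives. With w
  = 1/z it is d/dz, sending w^n to - n w^(n+1), whence the rising factorial.\<close>

lemma poly_dc_pow:
  assumes "poly qp a = 0"
  shows "poly ((dc d ^^ k) f $ (n + k)) a = (-1) ^ k * pochhammer (of_nat n) k * poly (f $ n) a"
  by (induction k) (simp_all add: dc_nth_Suc assms pochhammer_Suc algebra_simps)

lemma dc_pow_dt: "(dc (d + 1) ^^ k) (dt d f) = dt d ((dc d ^^ k) f)"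
  by (induction k) (auto simp: dt_dc[simplified])

text \<open>The Taylor coefficients of 2 sinh(X/2).\<close>

definition sinhc :: "nat \<Rightarrow> complex" where
  "sinhc k = ((1/2) ^ k - (-1/2) ^ k) / fact k"

lemma sinhc_even: "even k \<Longrightarrow> sinhc k = 0"
  by (auto simp: sinhc_def elim!: evenE simp: power_mult)

lemma rp_minus_rm_nth: "(rp - rm) $ n = (\<Sum>k\<le>n. smult (sinhc k) ((dc 1 ^^ k) Ric $ n))"
proof -
  have "(rp - rm) $ n = (\<Sum>k\<le>n. divpow (1/2) 1 k Ric $ n - divpow (-1/2) 1 k Ric $ n)"
    by (simp add: rp_def rm_def sh_def sum_subtractf)
  also have "\<dots> = (\<Sum>k\<le>n. smult (sinhc k) ((dc 1 ^^ k) Ric $ n))"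
    by (intro sum.cong refl) (simp add: divpow_def sinhc_def diff_divide_distrib smult_diff_left)
  finally show ?thesis .
qed

text \<open>The polynomial P_j; the quotient is exact for j at least 2.\<close>

definition vorosprim :: "nat \<Rightarrow> complex poly" where
  "vorosprim j = prim (smult (2/3) (Ric $ j div qp ^ 2))"

lemma vorosprim:
  assumes "j \<ge> 2"
  shows "smult (3/2) (qp ^ 2 * pderiv (vorosprim j)) = Ric $ j"
proof -
  have "qp ^ 2 dvd Ric $ j"
    using qreg_Ric assms unfolding qreg_def by (meson dvd_trans le_imp_power_dvd)
  then show ?thesis by (simp add: vorosprim_def pderiv_prim)
qed

lemma poly_vorosprim_0 [simp]: "poly (vorosprim j) 0 = 0"
  by (simp add: vorosprim_def)

text \<open>Borel coefficients of the values P_j(1/2); index 0 is reserved for the contribution of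
  sqrt Delta.\<close>

definition voros :: "nat \<Rightarrow> complex" where
  "voros j = (if j = 0 then -1 else if even j then poly (vorosprim j) (1/2) / fact (j - 2) else 0)"

text \<open>P_j stands at order j - 1 because \<open>dt\<close> raises the order by one:
  \<open>dt 0 VV\<close> is the part of \<open>Ric\<close> of even order at least 2.\<close>

definition VV :: pser where "VV = Abs_fps (\<lambda>n. if odd n then vorosprim (Suc n) else 0)"
text \<open>The t-antiderivative of the second c-derivative of sqrt Delta, as \<open>dc_dc_1\<close>
  shows.\<close>

definition hh :: pser where "hh = ww * (- 4 * xx * (6 * xx ^ 2 - 1))"

lemma hh_const: "hh = ww * fps_const [:0, 4, 0, -24:]"
proof -
  have "- 4 * xx * (6 * xx ^ 2 - 1) = fps_const (- 4 * [:0,1:] * (6 * [:0,1:]^2 - 1))"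
    unfolding xx_def by (simp add: numeral_fps_const)
  also have "- 4 * [:0,1:] * (6 * [:0,1:]^2 - 1) = ([:0, 4, 0, -24:] :: complex poly)"
    by (simp add: numeral_poly power2_eq_square one_pCons)
  finally show ?thesis by (simp add: hh_def)
qed

lemma dc_dc_1: "dc 1 (dc 1 1) = dt 0 hh"
proof -
  have 1: "dc 1 1 = - 6 * (ww * (qq * xx))" by (simp add: dc_def algebra_simps)
  have "dX (dc 1 1) = - 6 * (ww * (q1 * xx + qq))"
    unfolding 1 by (simp add: algebra_simps)
  moreover have "dW (dc 1 1) = - 6 * (ww * (qq * xx))"
    unfolding 1 by (simp add: algebra_simps)
  moreover have "dX hh = - 4 * ww * (18 * xx ^ 2 - 1)"
    unfolding hh_def by (simp add: algebra_simps power2_eq_square)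
  ultimately show ?thesis
    unfolding dc_def[of 1 "dc 1 1"] dt_def[of 0 hh] unfolding 1 unfolding q1_def qq_eq
    using hf2 by (simp, algebra)
qed

lemma dc_pow_1:
  "n < k \<or> k < n \<Longrightarrow> (dc d ^^ k) 1 $ n = 0"
proof (erule disjE)
  assume "k < n"
  then obtain m where "n = Suc m + k" by (metis add.commute add_Suc_right less_iff_Suc_add)
  then have "(dc d ^^ k) 1 $ n = (dc d ^^ k) 0 $ n"
    using dc_pow_cong[of 1 "Suc m" 0] by simp
  also have "(dc d ^^ k) 0 = 0" by (induction k) (simp_all add: dc_0)
  finally show ?thesis by simp
qed (rule dc_pow_order)

text \<open>Only odd k have nonzero \<open>sinhc k\<close>, so at odd order m just the even
  coefficients of \<open>Ric\<close> enter, and these are 1 plus the exact series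
  \<open>dt 0 VV\<close>. The summand 1 contributes only at k = m, where two of the m derivatives in
  c are spent on making it exact.\<close>

lemma rp_minus_rm_odd:
  assumes "odd m" "m \<ge> 3"
  shows "(rp - rm) $ m = dt 0 (fps_const [:sinhc m:] * (dc 0 ^^ (m - 2)) hh
     + (\<Sum>k\<le>m. fps_const [:sinhc k:] * (dc 0 ^^ k) VV)) $ m"
proof -
  have R: "Ric $ n = (1 + dt 0 VV) $ n" if "even n" for n
  proof (cases n)
    case 0 then show ?thesis by (simp add: Ric_0)
  next
    case (Suc i)
    then have "odd i" using that by auto
    then show ?thesis using Suc vorosprim[of n] by (cases i) (auto simp: dt_0_nth_Suc VV_def)
  qed
  have "(rp - rm) $ m = (\<Sum>k\<le>m. smult (sinhc k) ((dc 1 ^^ k) 1 $ m) + smult (sinhc k) (dt 0 ((dc 0 ^^ k) VV) $ m))"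
    unfolding rp_minus_rm_nth
  proof (intro sum.cong refl)
    fix k assume "k \<in> {..m}"
    then have k: "m = m - k + k" by simp
    show "smult (sinhc k) ((dc 1 ^^ k) Ric $ m)
      = smult (sinhc k) ((dc 1 ^^ k) 1 $ m) + smult (sinhc k) (dt 0 ((dc 0 ^^ k) VV) $ m)"
    proof (cases "even k")
      case True then show ?thesis by (simp add: sinhc_even)
    next
      case False
      then have "even (m - k)" using assms by auto
      then have "(dc 1 ^^ k) Ric $ (m - k + k) = (dc 1 ^^ k) (1 + dt 0 VV) $ (m - k + k)"
        by (intro dc_pow_cong R)
      moreover have "(dc 1 ^^ k) (f + g) = (dc 1 ^^ k) f + (dc 1 ^^ k) g" for f g
        by (induction k) (auto simp: dc_add)
      moreover have "(dc 1 ^^ k) (dt 0 VV) = dt 0 ((dc 0 ^^ k) VV)"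
        using dc_pow_dt[where d = 0] by simp
      ultimately show ?thesis unfolding k[symmetric] by (simp add: smult_add_right)
    qed
  qed
  also have "\<dots> = (\<Sum>k\<le>m. smult (sinhc k) ((dc 1 ^^ k) 1 $ m)) + (\<Sum>k\<le>m. smult (sinhc k) (dt 0 ((dc 0 ^^ k) VV) $ m))"
    by (rule sum.distrib)
  also have "(\<Sum>k\<le>m. smult (sinhc k) ((dc 1 ^^ k) 1 $ m)) = (\<Sum>k\<in>{m}. smult (sinhc k) ((dc 1 ^^ k) 1 $ m))"
    by (rule sum.mono_neutral_right) (use dc_pow_1 in \<open>auto simp: less_le\<close>)
  also have "\<dots> = smult (sinhc m) ((dc 1 ^^ m) 1 $ m)" by simp
  also have "(dc 1 ^^ m) 1 = dt 0 ((dc 0 ^^ (m - 2)) hh)"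
  proof -
    have "m = (m - 2) + 2" using assms by simp
    then have "(dc 1 ^^ m) 1 = (dc 1 ^^ (m - 2)) ((dc 1 ^^ 2) 1)" by (metis funpow_add o_apply)
    also have "(dc 1 ^^ 2) 1 = dt 0 hh" by (simp add: numeral_2_eq_2 dc_dc_1[simplified])
    finally show ?thesis using dc_pow_dt[where d = 0 and k = "m - 2" and f = hh] by simp
  qed
  finally show ?thesis by (simp add: dt_add dt_const dt_sum fps_sum_nth)
qed

text \<open>\<Gamma> and \<open>P\<close> have the same x-derivative at order n and both vanish at x
  = 0, so they coincide there as polynomials. Since \<Gamma> vanishes at x = 1/2, so does
  \<open>P\<close>, and this value is the asserted sum up to a factorial.\<close>

lemma voros_recursion_odd:
  assumes "odd m" "m \<ge> 3"
  shows "(\<Sum>k\<le>m. sinhc k * voros (m - k)) = 0"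
proof -
  obtain \<Gamma> where G: "rp - rm = - 6 * (ww * (xx * qq)) + dt 0 \<Gamma>" "evx 0 \<Gamma> = 0" "\<Gamma> $ 0 = 0"
    by (rule rp_minus_rm_exact)
  obtain n where m: "m = Suc n" using assms by (cases m) auto
  define P where "P = fps_const [:sinhc m:] * (dc 0 ^^ (m - 2)) hh
     + (\<Sum>k\<le>m. fps_const [:sinhc k:] * (dc 0 ^^ k) VV)"
  have q0: "poly qp 0 = 0" and q2: "poly qp (1/2) = 0" by (simp_all add: qp_def)
  have hn: "hh $ i = (if i = 1 then [:0, 4, 0, -24:] else 0)" for i
    unfolding hh_const ww_def by simp
  have Pa: "poly (P $ n) a = sinhc m * (fact (m - 2) * poly [:0, 4, 0, -24:] a * (-1))
     + (\<Sum>k\<le>n. sinhc k * ((-1) ^ k * pochhammer (of_nat (n - k)) k * poly (VV $ (n - k)) a))"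
    if "poly qp a = 0" for a
  proof -
    have "poly ((dc 0 ^^ (m - 2)) hh $ n) a = fact (m - 2) * poly [:0, 4, 0, -24:] a * (-1)"
    proof -
      have e: "n = 1 + (m - 2)" using m assms by simp
      have "odd (m - 2)" using assms by auto
      then have s: "(-1::complex) ^ (m - 2) = -1" by simp
      show ?thesis unfolding e poly_dc_pow[OF that] s hn
        by (simp add: pochhammer_fact[symmetric] m)
    qed
    moreover have "(\<Sum>k\<le>m. poly ((fps_const [:sinhc k:] * (dc 0 ^^ k) VV) $ n) a)
      = (\<Sum>k\<le>n. sinhc k * ((-1) ^ k * pochhammer (of_nat (n - k)) k * poly (VV $ (n - k)) a))"
    proof -
      have "(\<Sum>k\<le>m. poly ((fps_const [:sinhc k:] * (dc 0 ^^ k) VV) $ n) a)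
        = (\<Sum>k\<le>n. poly ((fps_const [:sinhc k:] * (dc 0 ^^ k) VV) $ n) a)"
        unfolding m using dc_pow_order[of n "Suc n" 0 VV] by simp
      also have "\<dots> = (\<Sum>k\<le>n. sinhc k * ((-1) ^ k * pochhammer (of_nat (n - k)) k * poly (VV $ (n - k)) a))"
      proof (intro sum.cong refl)
        fix k assume "k \<in> {..n}"
        then have "n = (n - k) + k" by simp
        then show "poly ((fps_const [:sinhc k:] * (dc 0 ^^ k) VV) $ n) a =
          sinhc k * ((-1) ^ k * pochhammer (of_nat (n - k)) k * poly (VV $ (n - k)) a)"
        proof -
          have "poly ((dc 0 ^^ k) VV $ n) a = (-1) ^ k * pochhammer (of_nat (n - k)) k * poly (VV $ (n - k)) a"
            using poly_dc_pow[OF that, where d = 0 and k = k and f = VV and n = "n - k"]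
            unfolding \<open>n = (n - k) + k\<close>[symmetric] .
          then show ?thesis by simp
        qed
      qed
      finally show ?thesis .
    qed
    ultimately show ?thesis by (simp add: P_def fps_sum_nth poly_sum)
  qed
  have "dt 0 \<Gamma> $ m = (rp - rm) $ m"
  proof -
    have "- 6 * (ww * (xx * qq)) = fps_X * fps_const (- 6 * [:0,1:] * qp)"
      by (simp add: ww_def xx_def qq_def numeral_fps_const algebra_simps)
    then show ?thesis unfolding G(1) using assms by simp
  qed
  also have "\<dots> = dt 0 P $ m" unfolding P_def by (rule rp_minus_rm_odd[OF assms])
  finally have "smult (3/2) (qp ^ 2 * pderiv (\<Gamma> $ n)) = smult (3/2) (qp ^ 2 * pderiv (P $ n))"
    unfolding m dt_0_nth_Suc .
  then have "smult (2/3) (smult (3/2) (qp ^ 2 * pderiv (\<Gamma> $ n)))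
      = smult (2/3) (smult (3/2) (qp ^ 2 * pderiv (P $ n)))" by simp
  then have "qp ^ 2 * pderiv (\<Gamma> $ n) = qp ^ 2 * pderiv (P $ n)"
    unfolding smult_smult by simp
  moreover have "qp ^ 2 \<noteq> 0" by (simp add: qp_def)
  ultimately have "pderiv (\<Gamma> $ n) = pderiv (P $ n)" by (metis mult_left_cancel)
  moreover have "poly (\<Gamma> $ n) 0 = 0" using arg_cong[OF G(2), of "\<lambda>f. f $ n"] by (simp add: evx_def)
  moreover have "poly (P $ n) 0 = 0" unfolding Pa[OF q0] by (auto simp: VV_def intro!: sum.neutral)
  ultimately have "\<Gamma> $ n = P $ n" by (metis poly_eqI_pderiv)
  moreover have "poly (\<Gamma> $ n) (1/2) = 0"
    using arg_cong[OF exact_part_vanishes[OF G], of "\<lambda>f. f $ n"] by (simp add: evx_def)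
  ultimately have "0 = poly (P $ n) (1/2)" by simp
  also have "\<dots> = - fact (m - 2) * (sinhc m * voros 0)
     + (\<Sum>k\<le>n. - fact (m - 2) * (sinhc k * voros (m - k)))"
    unfolding Pa[OF q2]
  proof (intro arg_cong2[where f = "(+)"] sum.cong refl)
    \<comment> \<open>The polynomial takes the value -1 at 1/2, which is \<open>voros 0\<close>; the
      other sign comes from the odd number of derivatives.\<close>
    show "sinhc m * (fact (m - 2) * poly [:0, 4, 0, - 24:] (1 / 2) * - 1) = - fact (m - 2) * (sinhc m * voros 0)"
      by (simp add: voros_def)
    fix k assume "k \<in> {..n}"
    then have k: "k \<le> n" by simp
    show "sinhc k * ((- 1) ^ k * pochhammer (of_nat (n - k)) k * poly (VV $ (n - k)) (1 / 2))
      = - fact (m - 2) * (sinhc k * voros (m - k))"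
    proof (cases "even k")
      case True then show ?thesis by (simp add: sinhc_even)
    next
      case False
      then have o: "odd (n - k)" and mk: "m - k = Suc (n - k)" using k assms m by auto
      then obtain i where i: "n - k = Suc i" by (cases "n - k") auto
      \<comment> \<open>The rising factorial is (i + k)!/i! with i + k = m - 2 and i = (m - k) - 2.
        Its denominator is the factorial in \<open>voros (m - k)\<close>, its numerator does not
        depend on k.\<close>
      have "pochhammer (of_nat (Suc i)) k * fact i = (fact (i + k) :: complex)"
        using pochhammer_product'[of "1::complex" i k] pochhammer_fact[of i, where 'a = complex] pochhammer_fact[of "i + k", where 'a = complex]
        by (simp add: mult.commute add.commute)
      moreover have "i + k = m - 2" using i m k by auto
      ultimately have "pochhammer (of_nat (n - k)) k = (fact (m - 2) / fact i :: complex)"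
        unfolding i by (simp add: field_simps del: of_nat_Suc)
      then show ?thesis using False o mk i by (simp add: VV_def voros_def)
    qed
  qed
  also have "\<dots> = - fact (m - 2) * (\<Sum>k\<le>m. sinhc k * voros (m - k))"
    unfolding m by (simp add: sum_distrib_left sum_negf algebra_simps)
  finally show ?thesis by simp
qed

text \<open>\<open>sinhc\<close> lives on odd and \<open>voros\<close> on even indices, so even m
  give 0; at m = 1 only \<open>sinhc 1 * voros 0\<close> is left.\<close>

lemma voros_recursion: "Abs_fps sinhc * Abs_fps voros = - fps_X"
proof (rule fps_ext)
  fix m
  have nth: "(Abs_fps sinhc * Abs_fps voros) $ m = (\<Sum>k\<le>m. sinhc k * voros (m - k))"
    by (simp add: fps_mult_nth atLeast0AtMost)
  consider "even m" | "m = 1" | "odd m" "m \<ge> 3"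
    by (cases "even m"; cases "m = 1") (auto elim!: oddE)
  then show "(Abs_fps sinhc * Abs_fps voros) $ m = (- fps_X) $ m"
  proof cases
    case 1
    have "(\<Sum>k\<le>m. sinhc k * voros (m - k)) = 0"
    proof (rule sum.neutral, rule ballI)
      fix k assume "k \<in> {..m}"
      then show "sinhc k * voros (m - k) = 0"
        using 1 by (cases "even k") (auto simp: sinhc_even voros_def)
    qed
    then show ?thesis unfolding nth using 1 by (auto simp: fps_X_def)
  next
    case 2
    then show ?thesis unfolding nth by (simp add: sinhc_def voros_def)
  next
    case 3
    then show ?thesis unfolding nth voros_recursion_odd[OF 3] by (auto simp: fps_X_def)
  qed
qed

section \<open>Comparison with the Bernoulli generating function\<close>

definition bern :: "complex fps" where
  "bern = Abs_fps (\<lambda>n. complex_of_real (fps_nth (fps_X / (fps_exp (1::real) - 1)) n))"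

definition fps_scale :: "complex \<Rightarrow> complex fps \<Rightarrow> complex fps" where
  "fps_scale a f = Abs_fps (\<lambda>n. a ^ n * f $ n)"

lemma fps_scale_mult: "fps_scale a (f * g) = fps_scale a f * fps_scale a g"
proof (rule fps_ext)
  fix n
  have "a ^ n * (f $ i * g $ (n - i)) = a ^ i * f $ i * (a ^ (n - i) * g $ (n - i))" if "i \<in> {0..n}" for i
  proof -
    have "a ^ n = a ^ i * a ^ (n - i)" using that by (simp add: power_add[symmetric])
    then show ?thesis by (simp only: mult_ac)
  qed
  then show "fps_scale a (f * g) $ n = (fps_scale a f * fps_scale a g) $ n"
    unfolding fps_scale_def fps_mult_nth fps_nth_Abs_fps sum_distrib_left by (rule sum.cong[OF refl])
qed

lemma bern_exp: "(fps_exp 1 - 1) * bern = fps_X"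
proof -
  define B where "B = fps_X / (fps_exp (1::real) - 1)"
  have s: "subdegree (fps_exp (1::real) - 1) = 1"
    by (rule subdegreeI) auto
  then have "(fps_exp (1::real) - 1) dvd fps_X"
    by (subst fps_dvd_iff) auto
  then have "(fps_exp (1::real) - 1) * B = fps_X" by (simp add: B_def)
  then have r: "(\<Sum>i=0..n. (fps_exp 1 - 1) $ i * B $ (n - i)) = (fps_X $ n :: real)" for n
    by (metis fps_mult_nth)
  show ?thesis
  proof (rule fps_ext)
    fix n
    have "((fps_exp 1 - 1) * bern) $ n = (\<Sum>i=0..n. complex_of_real ((fps_exp 1 - 1) $ i * B $ (n - i)))"
      unfolding fps_mult_nth by (intro sum.cong refl) (simp add: bern_def B_def)
    also have "\<dots> = complex_of_real (fps_X $ n)" unfolding of_real_sum[symmetric] r ..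
    finally show "((fps_exp 1 - 1) * bern) $ n = fps_X $ n" by (simp add: fps_X_def)
  qed
qed

text \<open>With e = exp(X/2), the identity 1/(e - 1) - 1/(e^2 - 1) = 1/(e - 1/e) expresses X/(2
  sinh(X/2)) through the Bernoulli series at X/2 and at X. This is the source of the factor 2^(1-2n)
  - 1.\<close>

lemma sinhc_bern: "Abs_fps sinhc * (2 * fps_scale (1/2) bern - bern) = fps_X"
proof -
  define e where "e = fps_exp (1/2 :: complex)"
  define e' where "e' = fps_exp (-1/2 :: complex)"
  have S: "Abs_fps sinhc = e - e'"
    by (rule fps_ext) (simp add: sinhc_def e_def e'_def diff_divide_distrib)
  have ee': "e * e' = 1" unfolding e_def e'_def fps_exp_add_mult[symmetric] by simp
  then have ee0: "e * e' - 1 = 0" by simp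
  have ee: "e * e = fps_exp 1" unfolding e_def fps_exp_add_mult[symmetric] by simp
  have "fps_scale (1/2) ((fps_exp 1 - 1) * bern) = fps_scale (1/2) fps_X" unfolding bern_exp ..
  moreover have "fps_scale (1/2) (fps_exp 1 - 1) = e - 1"
    by (rule fps_ext) (auto simp: fps_scale_def e_def)
  moreover have "2 * fps_scale (1/2) fps_X = fps_X"
    by (rule fps_ext) (auto simp: fps_scale_def fps_X_def numeral_fps_const)
  ultimately have 1: "2 * ((e - 1) * fps_scale (1/2) bern) = fps_X" by (simp add: fps_scale_mult)
  have 2: "(e * e - 1) * bern = fps_X" unfolding ee by (rule bern_exp)
  define H where "H = fps_scale (1/2) bern"
  \<comment> \<open>The last summand vanishes because e e' = 1; it makes the equation an identity
    between polynomials in e and e'.\<close>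
  have "(e - e') * (2 * H - bern) = e' * ((e + 1) * (2 * ((e - 1) * H)) - (e * e - 1) * bern)
      + (e * e' - 1) * (bern - 2 * H) * e"
    by (simp add: algebra_simps)
  also have "\<dots> = (e * e') * fps_X"
    unfolding H_def 1 2 ee0 by (simp add: algebra_simps)
  finally show ?thesis unfolding S H_def ee' by simp
qed

lemma voros_eq:
  assumes "j \<ge> 2" "even j"
  shows "poly (vorosprim j) (1/2) = - complex_of_real ((2 powr (1 - real j) - 1) / (real j * (real j - 1)) * bernoulli_num j)"
proof -
  have "Abs_fps sinhc * Abs_fps voros = Abs_fps sinhc * (- (2 * fps_scale (1/2) bern - bern))"
    unfolding voros_recursion using sinhc_bern by (simp add: algebra_simps)
  moreover have "Abs_fps sinhc \<noteq> 0"
  proof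
    assume "Abs_fps sinhc = 0"
    then have "sinhc 1 = 0" by (metis fps_nth_Abs_fps fps_zero_nth)
    then show False by (simp add: sinhc_def)
  qed
  ultimately have "Abs_fps voros = - (2 * fps_scale (1/2) bern - bern)" by (metis mult_left_cancel)
  then have "voros j = - (2 * (1/2) ^ j - 1) * bern $ j"
    by (simp add: fps_eq_iff fps_scale_def numeral_fps_const algebra_simps)
  then have v: "poly (vorosprim j) (1/2) = - (2 * (1/2) ^ j - 1) * bern $ j * fact (j - 2)"
    using assms by (simp add: voros_def field_simps)
  have b: "bern $ j = complex_of_real (bernoulli_num j / fact j)"
    by (simp add: bern_def bernoulli_num_def)
  have p: "2 powr (1 - real j) = 2 * (1/2) ^ j"
    by (simp add: powr_diff powr_realpow power_divide)
  have f: "(fact j :: real) = real j * (real j - 1) * fact (j - 2)"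
  proof -
    obtain i where "j = Suc (Suc i)" using assms by (metis add_2_eq_Suc le_Suc_ex)
    then show ?thesis by (simp add: algebra_simps)
  qed
  have "real j * (real j - 1) \<noteq> 0" using assms by auto
  then have "(bernoulli_num j / fact j) * fact (j - 2) = bernoulli_num j / (real j * (real j - 1))"
    unfolding f by (simp add: field_simps)
  then have "complex_of_real (bernoulli_num j / fact j) * fact (j - 2)
      = complex_of_real (bernoulli_num j / (real j * (real j - 1)))"
    by (metis of_real_fact of_real_mult)
  then have "poly (vorosprim j) (1/2)
      = - (2 * (1/2) ^ j - 1) * complex_of_real (bernoulli_num j / (real j * (real j - 1)))"
    unfolding v b by (simp only: mult.assoc)
  then show ?thesis unfolding p by (simp add: left_diff_distrib diff_divide_distrib)
qed

section \<open>The Riccati coefficients on the Riemann surface\<close>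

text \<open>The coefficient of eta^(-n) in the function represented by the series F of degree d.\<close>

definition val :: "complex \<Rightarrow> complex \<Rightarrow> complex \<Rightarrow> nat \<Rightarrow> pser \<Rightarrow> nat \<Rightarrow> complex" where
  "val c l s d F n = s ^ d * poly (F $ n) (l / s) / c ^ n"

lemma on_surfD:
  assumes "on_surf c t l s"
  shows "c = s ^ 3 * poly qp (l / s)" "t = s ^ 2 * (1 - 6 * (l / s) ^ 2)"
    "s ^ 2 = 6 * l ^ 2 + t" "s \<noteq> 0"
proof -
  have s: "s \<noteq> 0" "s ^ 2 = 6 * l ^ 2 + t" and c: "2 * l ^ 3 + t * l + c = 0"
    using assms by (auto simp: on_surf_def)
  have "s ^ 3 * poly qp (l / s) = 4 * l ^ 3 - l * s ^ 2"
    using s(1) by (simp add: qp_def field_simps power2_eq_square power3_eq_cube)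
  also have "\<dots> = c" unfolding s(2) using c by algebra
  finally show "c = s ^ 3 * poly qp (l / s)" ..
  have "s ^ 2 * (l / s) ^ 2 = l ^ 2" using s(1) by (simp add: power_divide)
  then show "t = s ^ 2 * (1 - 6 * (l / s) ^ 2)"
    using s(2) by (simp add: right_diff_distrib)
qed (use assms in \<open>auto simp: on_surf_def\<close>)

lemma loc_branch_deriv:
  assumes "loc_branch c U lb sb" "t \<in> U"
  shows "(lb has_field_derivative (- lb t / sb t ^ 2)) (at t)"
    "(sb has_field_derivative ((1 - 12 * (lb t / sb t) ^ 2) / (2 * sb t))) (at t)"
proof -
  have U: "open U" and h: "lb holomorphic_on U" "sb holomorphic_on U"
    and os: "\<And>t. t \<in> U \<Longrightarrow> on_surf c t (lb t) (sb t)"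
    using assms(1) by (auto simp: loc_branch_def)
  have s0: "sb t \<noteq> 0" and s2: "sb t ^ 2 = 6 * lb t ^ 2 + t" using on_surfD[OF os[OF assms(2)]] by auto
  have l: "(lb has_field_derivative deriv lb t) (at t)" and s: "(sb has_field_derivative deriv sb t) (at t)"
    using h U assms(2) by (auto intro: holomorphic_derivI)
  have "((\<lambda>t. 2 * lb t ^ 3 + t * lb t + c) has_field_derivative
      (6 * lb t ^ 2 * deriv lb t + lb t + t * deriv lb t)) (at t)"
    by (rule derivative_eq_intros l refl | simp)+
  moreover have "((\<lambda>t. 2 * lb t ^ 3 + t * lb t + c) has_field_derivative 0) (at t)"
    by (rule has_field_derivative_transform_within_open[where f = "\<lambda>_. 0" and S = U])
       (use U assms(2) os in \<open>auto simp: on_surf_def\<close>)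
  ultimately have "6 * lb t ^ 2 * deriv lb t + lb t + t * deriv lb t = 0" by (rule DERIV_unique)
  then have "sb t ^ 2 * deriv lb t = - lb t" unfolding s2 by algebra
  then have dl: "deriv lb t = - lb t / sb t ^ 2" using s0 by (simp add: field_simps)
  have "((\<lambda>t. sb t ^ 2 - 6 * lb t ^ 2 - t) has_field_derivative
      (2 * sb t * deriv sb t - 12 * lb t * deriv lb t - 1)) (at t)"
    by (rule derivative_eq_intros l s refl | simp)+
  moreover have "((\<lambda>t. sb t ^ 2 - 6 * lb t ^ 2 - t) has_field_derivative 0) (at t)"
    by (rule has_field_derivative_transform_within_open[where f = "\<lambda>_. 0" and S = U])
       (use U assms(2) os in \<open>auto simp: on_surf_def\<close>)
  ultimately have "2 * sb t * deriv sb t - 12 * lb t * deriv lb t - 1 = 0" by (rule DERIV_unique)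
  then have "deriv sb t = (1 - 12 * (lb t / sb t) ^ 2) / (2 * sb t)"
    unfolding dl using s0 by (simp add: field_simps power2_eq_square)
  with dl l s show "(lb has_field_derivative (- lb t / sb t ^ 2)) (at t)"
    "(sb has_field_derivative ((1 - 12 * (lb t / sb t) ^ 2) / (2 * sb t))) (at t)" by auto
qed

lemma val_deriv:
  assumes "loc_branch c U lb sb" "t \<in> U" "c \<noteq> 0"
  shows "((\<lambda>t. val c (lb t) (sb t) d F n) has_field_derivative
      val c (lb t) (sb t) (d + 1) (dt d F) (Suc n)) (at t)"
proof -
  define l s where "l = lb t" and "s = sb t"
  define x where "x = l / s"
  have os: "on_surf c t l s" using assms(1,2) by (auto simp: loc_branch_def l_def s_def)
  have s0: "s \<noteq> 0" and c: "c = s ^ 3 * poly qp x" using on_surfD[OF os] by (auto simp: x_def)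
  have lx: "l = x * s" using s0 by (simp add: x_def)
  have q0: "poly qp x \<noteq> 0" using c assms(3) by auto
  note D = loc_branch_deriv[OF assms(1,2), folded l_def s_def, folded x_def]
  have x': "((\<lambda>t. lb t / sb t) has_field_derivative (3/2 * poly qp x / s ^ 2)) (at t)"
  proof -
    have "((\<lambda>t. lb t / sb t) has_field_derivative
       ((- l / s ^ 2) * s - l * ((1 - 12 * x ^ 2) / (2 * s))) / (s * s)) (at t)"
      unfolding l_def s_def by (rule DERIV_divide) (use D s0 in \<open>simp_all add: l_def s_def\<close>)
    moreover have "((- l / s ^ 2) * s - l * ((1 - 12 * x ^ 2) / (2 * s))) / (s * s) = 3/2 * poly qp x / s ^ 2"
      unfolding lx qp_def using s0 by (simp add: field_simps power2_eq_square power3_eq_cube)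
    ultimately show ?thesis by simp
  qed
  have P: "((\<lambda>t. poly (F $ n) (lb t / sb t)) has_field_derivative
      poly (pderiv (F $ n)) x * (3/2 * poly qp x / s ^ 2)) (at t)"
    using DERIV_chain2[OF poly_DERIV x', of "F $ n"] by (simp add: x_def l_def s_def)
  have S: "((\<lambda>t. sb t ^ d) has_field_derivative (of_nat d * s ^ d * (1 - 12 * x ^ 2) / (2 * s ^ 2))) (at t)"
  proof -
    have "((\<lambda>t. sb t ^ d) has_field_derivative (of_nat d * (s ^ (d - Suc 0) * ((1 - 12 * x ^ 2) / (2 * s))))) (at t)"
      unfolding s_def using DERIV_power[OF D(2), of d] by (simp add: s_def mult_ac)
    moreover have "of_nat d * (s ^ (d - Suc 0) * ((1 - 12 * x ^ 2) / (2 * s))) = of_nat d * s ^ d * (1 - 12 * x ^ 2) / (2 * s ^ 2)"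
      using s0 by (cases d) (simp_all add: field_simps power2_eq_square)
    ultimately show ?thesis by simp
  qed
  have "((\<lambda>t. val c (lb t) (sb t) d F n) has_field_derivative
      (of_nat d * s ^ d * (1 - 12 * x ^ 2) / (2 * s ^ 2) * poly (F $ n) x
       + poly (pderiv (F $ n)) x * (3/2 * poly qp x / s ^ 2) * s ^ d) / c ^ n) (at t)"
    unfolding val_def using DERIV_cdivide[OF DERIV_mult[OF S P], of "c ^ n"] by (simp add: x_def l_def s_def)
  moreover have "(of_nat d * s ^ d * (1 - 12 * x ^ 2) / (2 * s ^ 2) * poly (F $ n) x
       + poly (pderiv (F $ n)) x * (3/2 * poly qp x / s ^ 2) * s ^ d) / c ^ n
     = val c l s (d + 1) (dt d F) (Suc n)"
  proof -
    have q': "poly (pderiv qp) x = 12 * x ^ 2 - 1" by (simp add: qp_def pderiv_pCons power2_eq_square)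
    have "val c l s (d + 1) (dt d F) (Suc n)
      = s ^ d * s * (poly qp x * (3/2 * (poly qp x * poly (pderiv (F $ n)) x)
          - of_nat d / 2 * ((12 * x ^ 2 - 1) * poly (F $ n) x))) / (c * c ^ n)"
      unfolding val_def x_def[symmetric] dt_nth_Suc by (simp add: q')
    \<comment> \<open>Raising the index adds one factor c to the denominator. Written as s^3 q it
      cancels the prefactor q of \<open>dt\<close> and lowers the power of s.\<close>
    also have "c * c ^ n = s * s ^ 2 * poly qp x * c ^ n" by (subst c) (simp add: power2_eq_square power3_eq_cube)
    finally have v: "val c l s (d + 1) (dt d F) (Suc n) = s ^ d * s *
        (poly qp x * (3/2 * (poly qp x * poly (pderiv (F $ n)) x)
          - of_nat d / 2 * ((12 * x ^ 2 - 1) * poly (F $ n) x))) / (s * s ^ 2 * poly qp x * c ^ n)" .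
    show ?thesis unfolding v using s0 q0 assms(3) by (simp add: field_simps)
  qed
  ultimately show ?thesis by (simp add: l_def s_def)
qed

lemma val_add: "val c l s d (F + G) n = val c l s d F n + val c l s d G n"
  by (simp add: val_def algebra_simps add_divide_distrib)

lemma val_mult:
  assumes "c \<noteq> 0"
  shows "(\<Sum>i\<le>n. val c l s d F i * val c l s e G (n - i)) = val c l s (d + e) (F * G) n"
proof -
  have "val c l s d F i * val c l s e G (n - i) = s ^ (d + e) * poly (F $ i * G $ (n - i)) (l / s) / c ^ n"
    if "i \<in> {..n}" for i
  proof -
    have "c ^ n = c ^ i * c ^ (n - i)" using that by (simp add: power_add[symmetric])
    then show ?thesis by (simp add: val_def power_add)
  qed
  then have "(\<Sum>i\<le>n. val c l s d F i * val c l s e G (n - i))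
     = (\<Sum>i\<le>n. s ^ (d + e) * poly (F $ i * G $ (n - i)) (l / s) / c ^ n)" by (intro sum.cong) auto
  also have "\<dots> = val c l s (d + e) (F * G) n"
    by (simp add: val_def fps_mult_nth poly_sum sum_distrib_left sum_divide_distrib atLeast0AtMost)
  finally show ?thesis .
qed

lemma tt_const: "tt = fps_const [:1, 0, -6:]"
proof (rule fps_ext)
  fix n show "tt $ n = fps_const [:1, 0, -6:] $ n"
    using tt_0 by (cases n) (auto simp: tt_def xx_def power2_eq_square numeral_fps_const)
qed

lemma val_tt_mult:
  assumes "on_surf c t l s"
  shows "val c l s (Suc (Suc d)) (tt * F) n = t * val c l s d F n"
proof -
  define p where "p = ([:1, 0, -6:] :: complex poly)"
  have p: "poly p (l / s) * s ^ 2 = t"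
  proof -
    have "poly p (l / s) * s ^ 2 = s ^ 2 * (1 - 6 * (l / s) ^ 2)"
      by (simp add: p_def power2_eq_square)
    also have "\<dots> = t" using on_surfD(2)[OF assms] ..
    finally show ?thesis .
  qed
  have "val c l s (Suc (Suc d)) (fps_const p * F) n = (poly p (l / s) * s ^ 2) * val c l s d F n"
    unfolding val_def by (simp add: power2_eq_square)
  then show ?thesis unfolding tt_const p_def[symmetric] p .
qed

definition lamv :: "complex \<Rightarrow> (complex \<Rightarrow> complex) \<Rightarrow> (complex \<Rightarrow> complex) \<Rightarrow> nat \<Rightarrow> complex \<Rightarrow> complex" where
  "lamv c lb sb n t = val c (lb t) (sb t) 1 Lam n"
definition nuv :: "complex \<Rightarrow> (complex \<Rightarrow> complex) \<Rightarrow> (complex \<Rightarrow> complex) \<Rightarrow> nat \<Rightarrow> complex \<Rightarrow> complex" where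
  "nuv c lb sb n t = val c (lb t) (sb t) 2 (dt 1 Lam) n"
definition ricv :: "complex \<Rightarrow> (complex \<Rightarrow> complex) \<Rightarrow> (complex \<Rightarrow> complex) \<Rightarrow> nat \<Rightarrow> complex \<Rightarrow> complex" where
  "ricv c lb sb n t = val c (lb t) (sb t) 1 Ric n"

lemma val_holomorphic:
  assumes "loc_branch c U lb sb" "c \<noteq> 0"
  shows "(\<lambda>t. val c (lb t) (sb t) d F n) holomorphic_on U"
proof -
  have "open U" using assms by (simp add: loc_branch_def)
  then show ?thesis using val_deriv[OF assms(1) _ assms(2)] holomorphic_on_open by blast
qed

lemma zero_param_sol_lamv:
  assumes b: "loc_branch c U lb sb" and c: "c \<noteq> 0"
  shows "zero_param_sol c U lb (lamv c lb sb) (nuv c lb sb)"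
  unfolding zero_param_sol_def
proof (intro conjI allI ballI)
  fix n
  show "lamv c lb sb n holomorphic_on U" "nuv c lb sb n holomorphic_on U"
    using val_holomorphic[OF b c] by (simp_all add: lamv_def[abs_def] nuv_def[abs_def])
next
  fix t assume t: "t \<in> U"
  have os: "on_surf c t (lb t) (sb t)" using b t by (auto simp: loc_branch_def)
  note s = on_surfD[OF os]
  show "lamv c lb sb 0 t = lb t" using s by (simp add: lamv_def val_def Lam_0)
  show "nuv c lb sb 0 t = 0" by (simp add: nuv_def val_def)
  fix n
  show "deriv (lamv c lb sb n) t = nuv c lb sb (n + 1) t"
    using DERIV_imp_deriv[OF val_deriv[OF b t c, of 1 Lam n]]
    by (simp add: lamv_def[abs_def] nuv_def numeral_2_eq_2)
  let ?v = "val c (lb t) (sb t)"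
  have "deriv (nuv c lb sb n) t = ?v 3 (dt 2 (dt 1 Lam)) (n + 1)"
    using DERIV_imp_deriv[OF val_deriv[OF b t c, of 2 "dt 1 Lam" n]]
    by (simp add: nuv_def[abs_def])
  also have "dt 2 (dt 1 Lam) = Lam * (Lam * Lam) + Lam * (Lam * Lam) + tt * Lam + qq"
    unfolding Lam_PII by (simp add: power3_eq_cube)
  also have "?v 3 \<dots> (n + 1) = 2 * ?v 3 (Lam * (Lam * Lam)) (n + 1) + t * lamv c lb sb (n + 1) t"
  proof -
    have "?v 3 (tt * Lam) (n + 1) = t * ?v 1 Lam (n + 1)"
      using val_tt_mult[OF os, of 1 Lam "n + 1"] by (simp add: numeral_3_eq_3)
    moreover have "?v 3 qq (n + 1) = 0" by (simp add: val_def qq_def)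
    ultimately show ?thesis unfolding val_add lamv_def by simp
  qed
  also have "?v 3 (Lam * (Lam * Lam)) (n + 1)
      = (\<Sum>a\<le>n + 1. \<Sum>b\<le>n + 1 - a. lamv c lb sb a t * lamv c lb sb b t * lamv c lb sb (n + 1 - a - b) t)"
  proof -
    have "?v (1 + (1 + 1)) (Lam * (Lam * Lam)) (n + 1)
       = (\<Sum>a\<le>n + 1. ?v 1 Lam a * (\<Sum>b\<le>n + 1 - a. ?v 1 Lam b * ?v 1 Lam (n + 1 - a - b)))"
      unfolding val_mult[OF c] ..
    then show ?thesis by (simp add: lamv_def sum_distrib_left mult.assoc numeral_3_eq_3)
  qed
  finally show "deriv (nuv c lb sb n) t =
    2 * (\<Sum>a\<le>n + 1. \<Sum>b\<le>n + 1 - a. lamv c lb sb a t * lamv c lb sb b t * lamv c lb sb (n + 1 - a - b) t)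
    + t * lamv c lb sb (n + 1) t" .
qed

lemma riccati_sol_ricv:
  assumes b: "loc_branch c U lb sb" and c: "c \<noteq> 0"
  shows "riccati_sol c U (lamv c lb sb) sb (ricv c lb sb)"
  unfolding riccati_sol_def
proof (intro conjI allI ballI)
  fix n
  show "ricv c lb sb n holomorphic_on U"
    using val_holomorphic[OF b c] by (simp add: ricv_def[abs_def])
next
  fix t assume t: "t \<in> U"
  have os: "on_surf c t (lb t) (sb t)" using b t by (auto simp: loc_branch_def)
  show "ricv c lb sb 0 t = sb t" by (simp add: ricv_def val_def Ric_0)
  fix m
  let ?v = "val c (lb t) (sb t)"
  have d: "(if m = 0 then 0 else deriv (ricv c lb sb (m - 1)) t) = ?v 2 (dt 1 Ric) m"
  proof (cases m)
    case (Suc k)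
    then show ?thesis using DERIV_imp_deriv[OF val_deriv[OF b t c, of 1 Ric k]]
      by (simp add: ricv_def[abs_def] numeral_2_eq_2)
  qed (simp add: val_def)
  have "(\<Sum>i\<le>m. ricv c lb sb i t * ricv c lb sb (m - i) t) + ?v 2 (dt 1 Ric) m
    = ?v 2 (Ric ^ 2 + dt 1 Ric) m"
    unfolding val_add ricv_def val_mult[OF c] power2_eq_square one_add_one ..
  also have "Ric ^ 2 + dt 1 Ric = fps_const [:6:] * Lam ^ 2 + tt * 1"
    unfolding Ric_Riccati by (simp add: numeral_fps_const numeral_poly)
  also have "?v 2 \<dots> m = 6 * ?v 2 (Lam ^ 2) m + t * ?v 0 1 m"
    unfolding val_add numeral_2_eq_2 val_tt_mult[OF os] by (simp add: val_def)
  also have "?v 2 (Lam ^ 2) m = (\<Sum>a\<le>m. lamv c lb sb a t * lamv c lb sb (m - a) t)"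
    unfolding lamv_def val_mult[OF c] power2_eq_square one_add_one ..
  also have "t * ?v 0 1 m = (if m = 0 then t else 0)"
    by (simp add: val_def)
  finally show "(\<Sum>i\<le>m. ricv c lb sb i t * ricv c lb sb (m - i) t)
      + (if m = 0 then 0 else deriv (ricv c lb sb (m - 1)) t)
    = 6 * (\<Sum>a\<le>m. lamv c lb sb a t * lamv c lb sb (m - a) t) + (if m = 0 then t else 0)"
    unfolding d .
qed

section \<open>Uniqueness of the formal solutions and existence of local branches\<close>

lemma deriv_cong_open:
  assumes "open U" "t \<in> U" "\<And>z. z \<in> U \<Longrightarrow> f z = g z"
  shows "deriv f t = deriv g t"
  by (rule deriv_cong_ev) (use assms in \<open>auto simp: eventually_nhds\<close>)

text \<open>At each order \<open>nu\<close> is a derivative already known, and the new coefficient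
  of \<open>lam\<close> enters linearly with factor 6 lambda_0^2 + t = s^2, nonzero on the
  surface.\<close>

lemma zero_param_sol_unique:
  assumes b: "loc_branch c U lb sb"
    and z: "zero_param_sol c U lb lam nu" and z': "zero_param_sol c U lb lam' nu'"
  shows "\<forall>i\<le>n. \<forall>t\<in>U. lam i t = lam' i t \<and> nu i t = nu' i t"
proof (induction n)
  case 0
  show ?case using z z' by (auto simp: zero_param_sol_def)
next
  case (Suc n)
  have U: "open U" using b by (simp add: loc_branch_def)
  have "lam (Suc n) t = lam' (Suc n) t \<and> nu (Suc n) t = nu' (Suc n) t" if t: "t \<in> U" for t
  proof
    have "deriv (lam n) t = deriv (lam' n) t" "deriv (nu n) t = deriv (nu' n) t"
      using Suc t by (auto intro!: deriv_cong_open[OF U])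
    then show "nu (Suc n) t = nu' (Suc n) t"
      using z z' t by (auto simp: zero_param_sol_def)
    define F where "F = Abs_fps (\<lambda>i. lam i t)"
    define G where "G = Abs_fps (\<lambda>i. lam' i t)"
    have cub: "(\<Sum>a\<le>n+1. \<Sum>b\<le>n+1-a. f a * f b * f (n+1-a-b)) = (Abs_fps f * (Abs_fps f * Abs_fps f)) $ (n+1)"
      for f :: "nat \<Rightarrow> complex"
      by (simp add: fps_mult_nth atLeast0AtMost sum_distrib_left mult.assoc)
    have "2 * (F * (F * F)) $ (n+1) + t * F $ (n+1) = 2 * (G * (G * G)) $ (n+1) + t * G $ (n+1)"
      using z z' t \<open>deriv (nu n) t = deriv (nu' n) t\<close>
      unfolding F_def G_def cub[symmetric] zero_param_sol_def by simp
    then have e: "2 * (F * (F * F) - G * (G * G)) $ (n+1) + t * (F - G) $ (n+1) = 0"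
      by (simp add: algebra_simps)
    have "F * (F * F) - G * (G * G) = (F - G) * (F * F + F * G + G * G)" by (simp add: algebra_simps)
    also have "\<dots> $ (n+1) = (F - G) $ (n+1) * (F * F + F * G + G * G) $ 0"
      by (rule fps_mult_nth_order) (use Suc t in \<open>auto simp: F_def G_def\<close>)
    also have "(F * F + F * G + G * G) $ 0 = 3 * lb t ^ 2"
      using z z' t by (simp add: F_def G_def zero_param_sol_def power2_eq_square)
    finally have f: "(F * (F * F) - G * (G * G)) $ (n+1) = (F - G) $ (n+1) * (3 * lb t ^ 2)" .
    have "2 * ((F - G) $ (n+1) * (3 * lb t ^ 2)) + t * (F - G) $ (n+1) = 0" using e unfolding f .
    then have "(F - G) $ (n+1) * (6 * lb t ^ 2 + t) = 0" by algebra
    moreover have "6 * lb t ^ 2 + t \<noteq> 0"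
      using b t by (auto simp: loc_branch_def on_surf_def)
    ultimately show "lam (Suc n) t = lam' (Suc n) t" by (auto simp: F_def G_def)
  qed
  then show ?case using Suc by (auto simp: le_Suc_eq)
qed

text \<open>The new coefficient occurs only in its product with 2 sqrt Delta, and sqrt Delta has no
  zero on the surface.\<close>

lemma riccati_sol_unique:
  assumes b: "loc_branch c U lb sb"
    and r: "riccati_sol c U lam sb Rr" and r': "riccati_sol c U lam' sb Rr'"
    and lam: "\<And>i t. t \<in> U \<Longrightarrow> lam i t = lam' i t"
  shows "\<forall>i\<le>n. \<forall>t\<in>U. Rr i t = Rr' i t"
proof (induction n)
  case 0
  show ?case using r r' by (auto simp: riccati_sol_def)
next
  case (Suc n)
  have U: "open U" using b by (simp add: loc_branch_def)
  have "Rr (Suc n) t = Rr' (Suc n) t" if t: "t \<in> U" for t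
  proof -
    have d: "deriv (Rr n) t = deriv (Rr' n) t"
      using Suc t by (auto intro!: deriv_cong_open[OF U])
    define F where "F = Abs_fps (\<lambda>i. Rr i t)"
    define G where "G = Abs_fps (\<lambda>i. Rr' i t)"
    have sq: "(\<Sum>a\<le>Suc n. f a * f (Suc n - a)) = (Abs_fps f * Abs_fps f) $ Suc n" for f :: "nat \<Rightarrow> complex"
      by (simp add: fps_mult_nth atLeast0AtMost)
    have E: "(\<Sum>i\<le>Suc n. R i t * R (Suc n - i) t) + deriv (R n) t = 6 * (\<Sum>a\<le>Suc n. L a t * L (Suc n - a) t)"
      if "riccati_sol c U L sb R" for R L
    proof -
      have "(\<Sum>i\<le>Suc n. R i t * R (Suc n - i) t) + (if Suc n = 0 then 0 else deriv (R (Suc n - 1)) t)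
        = 6 * (\<Sum>a\<le>Suc n. L a t * L (Suc n - a) t) + (if Suc n = 0 then t else 0)"
        using that t unfolding riccati_sol_def by blast
      then show ?thesis by (simp del: sum.atMost_Suc)
    qed
    have "(F * F) $ Suc n = (G * G) $ Suc n"
    proof -
      have "(\<Sum>i\<le>Suc n. Rr i t * Rr (Suc n - i) t) + deriv (Rr n) t
        = (\<Sum>i\<le>Suc n. Rr' i t * Rr' (Suc n - i) t) + deriv (Rr' n) t"
        unfolding E[OF r] E[OF r'] using lam[OF t] by (simp del: sum.atMost_Suc)
      then show ?thesis using d unfolding F_def G_def sq[symmetric] by (simp del: sum.atMost_Suc)
    qed
    then have e: "(F * F - G * G) $ Suc n = 0" by simp
    have "F * F - G * G = (F - G) * (F + G)" by (simp add: algebra_simps)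
    also have "\<dots> $ Suc n = (F - G) $ Suc n * (F + G) $ 0"
      by (rule fps_mult_nth_order) (use Suc t in \<open>auto simp: F_def G_def\<close>)
    also have "(F + G) $ 0 = 2 * sb t"
      using r r' t by (simp add: F_def G_def riccati_sol_def)
    finally have "(F - G) $ Suc n * (2 * sb t) = 0" using e by simp
    moreover have "sb t \<noteq> 0" using b t by (auto simp: loc_branch_def on_surf_def)
    ultimately show ?thesis by (auto simp: F_def G_def)
  qed
  then show ?case using Suc by (auto simp: le_Suc_eq)
qed

text \<open>The cubic is solved for t instead of lambda_0: t = -2 l^2 - c/l, where l is nonzero
  because c is. The derivative of this function of l is - s^2/l, so it is locally invertible away
  from turning points.\<close>

lemma loc_branch_exists:
  assumes os: "on_surf c t0 l0 s0" and c: "c \<noteq> 0"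
  obtains U lb sb where "t0 \<in> U" "lb t0 = l0" "sb t0 = s0" "loc_branch c U lb sb"
proof -
  have s0: "s0 \<noteq> 0" "s0 ^ 2 = 6 * l0 ^ 2 + t0" "2 * l0 ^ 3 + t0 * l0 + c = 0"
    using os by (auto simp: on_surf_def)
  have l0: "l0 \<noteq> 0" using s0(3) c by auto
  define f where "f = (\<lambda>z::complex. - 2 * z ^ 2 - c / z)"
  have f: "2 * z ^ 3 + f z * z + c = 0" if "z \<noteq> 0" for z
    using that by (simp add: f_def field_simps power2_eq_square power3_eq_cube)
  have fh: "f holomorphic_on - {0}" unfolding f_def by (intro holomorphic_intros) auto
  have ft: "f l0 = t0"
  proof -
    have "f l0 * l0 = t0 * l0" using f[OF l0] s0(3) by (metis add_right_cancel add_left_cancel)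
    then show ?thesis using l0 by simp
  qed
  have "(f has_field_derivative (- 4 * l0 + c / l0 ^ 2)) (at l0)"
    unfolding f_def by (rule derivative_eq_intros refl l0 | simp add: l0 power2_eq_square)+
  then have "deriv f l0 = - 4 * l0 + c / l0 ^ 2" by (rule DERIV_imp_deriv)
  also have "\<dots> = - (s0 ^ 2) / l0"
  proof -
    have "c = - 2 * l0 ^ 3 - t0 * l0" using s0(3) by algebra
    then have "c / l0 ^ 2 = - 2 * l0 - t0 / l0"
      using l0 by (simp add: diff_divide_distrib power2_eq_square power3_eq_cube)
    then show ?thesis unfolding s0(2) using l0
      by (simp add: add_divide_distrib diff_divide_distrib power2_eq_square)
  qed
  finally have d: "deriv f l0 \<noteq> 0" using s0(1) l0 by simp
  obtain r where r: "r > 0" "ball l0 r \<subseteq> - {0}" "open (f ` ball l0 r)" "inj_on f (ball l0 r)"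
    using has_complex_derivative_locally_invertible[OF fh _ _ d] l0 by (auto simp: open_Compl)
  have fhb: "f holomorphic_on ball l0 r" using fh r(2) by (rule holomorphic_on_subset)
  obtain lb where lb: "lb holomorphic_on (f ` ball l0 r)" "\<And>z. z \<in> ball l0 r \<Longrightarrow> lb (f z) = z"
    using holomorphic_has_inverse[OF fhb open_ball r(4)] by metis
  define V where "V = f ` ball l0 r"
  have t0V: "t0 \<in> V" unfolding V_def using r(1) ft by force
  have lbt: "lb t0 = l0" using lb(2)[of l0] r(1) ft by simp
  have lbV: "2 * lb t ^ 3 + t * lb t + c = 0" if "t \<in> V" for t
  proof -
    obtain z where z: "z \<in> ball l0 r" "t = f z" using \<open>t \<in> V\<close> by (auto simp: V_def)
    then have "z \<noteq> 0" using r(2) by blast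
    then show ?thesis using f lb(2)[OF z(1)] z(2) by simp
  qed
  \<comment> \<open>Division by s0^2 makes the radicand 1 at t0: the principal root is holomorphic
    near t0, and the factor s0 in \<open>sb\<close> selects the sheet.\<close>
  define h where "h = (\<lambda>t. (6 * lb t ^ 2 + t) / s0 ^ 2)"
  have hh: "h holomorphic_on V" unfolding h_def V_def by (intro holomorphic_intros lb) (use s0 in auto)
  have ht: "h t0 = 1" unfolding h_def lbt s0(2)[symmetric] using s0(1) by simp
  define U where "U = V \<inter> h -` (- \<real>\<^sub>\<le>\<^sub>0)"
  have oU: "open U"
    unfolding U_def using holomorphic_on_imp_continuous_on[OF hh] r(3)
    by (intro continuous_open_preimage) (auto simp: V_def closed_nonpos_Reals_complex)
  define sb where "sb = (\<lambda>t. s0 * csqrt (h t))"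
  have "loc_branch c U lb sb"
    unfolding loc_branch_def
  proof (intro conjI ballI)
    show "lb holomorphic_on U" using lb(1) by (rule holomorphic_on_subset) (auto simp: U_def V_def)
    have "h holomorphic_on U" using hh by (rule holomorphic_on_subset) (auto simp: U_def)
    then show "sb holomorphic_on U"
      unfolding sb_def by (intro holomorphic_intros) (auto simp: U_def)
    fix t assume t: "t \<in> U"
    have "sb t ^ 2 = s0 ^ 2 * h t" by (simp add: sb_def power_mult_distrib)
    also have "\<dots> = 6 * lb t ^ 2 + t" using s0(1) by (simp add: h_def)
    finally have "sb t ^ 2 = 6 * lb t ^ 2 + t" .
    moreover have "h t \<noteq> 0" using t by (auto simp: U_def)
    then have "sb t \<noteq> 0" using s0(1) by (simp add: sb_def)
    ultimately show "on_surf c t (lb t) (sb t)" using lbV t by (auto simp: on_surf_def U_def)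
  qed (rule oU)
  moreover have "t0 \<in> U" using t0V ht by (simp add: U_def)
  moreover have "sb t0 = s0" by (simp add: sb_def ht)
  ultimately show thesis using lbt that by blast
qed

text \<open>The universal series gives a solution on any local branch, and by uniqueness every
  solution equals it. Its value depends only on the point of the surface, so the definite
  description is meaningful.\<close>

lemma Rcoef_eq:
  assumes os: "on_surf c t l s" and c: "c \<noteq> 0"
  shows "Rcoef c j t l s = val c l s 1 Ric j"
  unfolding Rcoef_def
proof (rule the_equality)
  obtain U lb sb where U: "t \<in> U" "lb t = l" "sb t = s" "loc_branch c U lb sb"
    using loc_branch_exists[OF os c] by metis
  show "\<exists>U lb sb lam nu Rr. t \<in> U \<and> lb t = l \<and> sb t = s \<and> loc_branch c U lb sb
      \<and> zero_param_sol c U lb lam nu \<and> riccati_sol c U lam sb Rr \<and> val c l s 1 Ric j = Rr j t"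
    using U zero_param_sol_lamv[OF U(4) c] riccati_sol_ricv[OF U(4) c]
    by (intro exI[of _ U] exI[of _ lb] exI[of _ sb] exI[of _ "lamv c lb sb"]
      exI[of _ "nuv c lb sb"] exI[of _ "ricv c lb sb"]) (simp add: ricv_def)
next
  fix v
  assume "\<exists>U lb sb lam nu Rr. t \<in> U \<and> lb t = l \<and> sb t = s \<and> loc_branch c U lb sb
      \<and> zero_param_sol c U lb lam nu \<and> riccati_sol c U lam sb Rr \<and> v = Rr j t"
  then obtain U lb sb lam nu Rr where U: "t \<in> U" "lb t = l" "sb t = s" "loc_branch c U lb sb"
    and z: "zero_param_sol c U lb lam nu" and r: "riccati_sol c U lam sb Rr" and v: "v = Rr j t" by blast
  have "lam i z = lamv c lb sb i z" if "z \<in> U" for i z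
    using zero_param_sol_unique[OF U(4) z zero_param_sol_lamv[OF U(4) c], of i] that by blast
  then have "Rr j t = ricv c lb sb j t"
    using riccati_sol_unique[OF U(4) r riccati_sol_ricv[OF U(4) c], of j] U(1) by blast
  then show "v = val c l s 1 Ric j" using U v by (simp add: ricv_def)
qed

lemma poly_rfl: "poly (rfl p) x = poly p (- x)"
  by (simp add: rfl_def poly_pcompose)

text \<open>Under the exchange of sheets the prefactor s changes sign and the polynomial of order j
  is multiplied by (-1)^j; exactly the even j, that is R_(2k-1), are odd under the exchange.\<close>

lemma Rodd_eq:
  assumes os: "on_surf c t l s" and c: "c \<noteq> 0"
  shows "Rodd c j t l s = (if even j then val c l s 1 Ric j else 0)"
proof -
  have "on_surf c t l (- s)" using os by (simp add: on_surf_def)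
  then have "Rodd c j t l s = (val c l s 1 Ric j - val c l (- s) 1 Ric j) / 2"
    using os c by (simp add: Rodd_def Rcoef_eq)
  moreover have "poly (Ric $ j) (- (l / s)) = (-1) ^ j * poly (Ric $ j) (l / s)"
    using par_Ric poly_rfl[of "Ric $ j" "l / s"] by (simp add: par_def)
  ultimately show ?thesis by (cases "even j") (simp_all add: val_def)
qed

section \<open>Integration along lifted paths\<close>

lemma has_vector_derivative_iff_quotient:
  fixes f :: "real \<Rightarrow> complex"
  shows "(f has_vector_derivative D) (at x within T) \<longleftrightarrow>
    ((\<lambda>y. (f y - f x) / of_real (y - x)) \<longlongrightarrow> D) (at x within T)"
proof -
  have "(f has_vector_derivative D) (at x within T) \<longleftrightarrow>
    ((\<lambda>y. norm ((f y - f x) - (y - x) *\<^sub>R D) / norm (y - x)) \<longlongrightarrow> 0) (at x within T)"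
    unfolding has_vector_derivative_def has_derivative_iff_norm
    by (simp add: bounded_linear_scaleR_left)
  also have "\<dots> \<longleftrightarrow> ((\<lambda>y. norm ((f y - f x) / of_real (y - x) - D)) \<longlongrightarrow> 0) (at x within T)"
  proof (rule tendsto_cong)
    have "norm ((f y - f x) - (y - x) *\<^sub>R D) / norm (y - x) = norm ((f y - f x) / of_real (y - x) - D)"
      if "y \<noteq> x" for y
    proof -
      have "(f y - f x) / of_real (y - x) - D = ((f y - f x) - (y - x) *\<^sub>R D) / of_real (y - x)"
        using that by (simp add: scaleR_conv_of_real diff_divide_distrib[of _ _ "of_real (y - x)"] del: of_real_diff)
      then show ?thesis by (simp only: norm_divide norm_of_real real_norm_def)
    qed
    then show "\<forall>\<^sub>F y in at x within T. norm ((f y - f x) - (y - x) *\<^sub>R D) / norm (y - x)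
        = norm ((f y - f x) / of_real (y - x) - D)"
      by (auto simp: eventually_at_filter)
  qed
  also have "\<dots> \<longleftrightarrow> ((\<lambda>y. (f y - f x) / of_real (y - x)) \<longlongrightarrow> D) (at x within T)"
    by (simp add: tendsto_norm_zero_iff Lim_null[symmetric])
  finally show ?thesis .
qed

lemma has_vector_derivative_factor:
  fixes f g :: "real \<Rightarrow> complex"
  assumes "(g has_vector_derivative g') (at x within T)" "(\<Psi> \<longlongrightarrow> K) (at x within T)"
    and "\<forall>\<^sub>F y in at x within T. f y - f x = (g y - g x) * \<Psi> y"
  shows "(f has_vector_derivative (g' * K)) (at x within T)"
proof -
  have "((\<lambda>y. (g y - g x) / of_real (y - x) * \<Psi> y) \<longlongrightarrow> g' * K) (at x within T)"
    using assms(1,2) unfolding has_vector_derivative_iff_quotient by (rule tendsto_mult)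
  moreover have "\<forall>\<^sub>F y in at x within T. (g y - g x) / of_real (y - x) * \<Psi> y = (f y - f x) / of_real (y - x)"
    using assms(3) by eventually_elim simp
  ultimately show ?thesis unfolding has_vector_derivative_iff_quotient
    by (rule Lim_transform_eventually)
qed

text \<open>The lift is only assumed continuous. Its increments are factored algebraically as
  increments of \<open>g\<close> times functions with known limits, so differentiability follows
  without choosing local branches along the path.\<close>

lemma lift_ratio_derivative:
  assumes g: "(g has_vector_derivative g') (at x within T)" and x: "x \<in> T"
    and L: "continuous_on T L" and S: "continuous_on T S"
    and os: "\<And>y. y \<in> T \<Longrightarrow> on_surf c (g y) (L y) (S y)"
  shows "((\<lambda>y. L y / S y) has_vector_derivative (g' * (3/2 * poly qp (L x / S x) / S x ^ 2))) (at x within T)"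
proof -
  define l s where "l = L x" and "s = S x"
  have s0: "s \<noteq> 0" and s2: "s ^ 2 = 6 * l ^ 2 + g x"
    using on_surfD[OF os[OF x]] by (simp_all add: l_def s_def)
  have tL: "(L \<longlongrightarrow> l) (at x within T)" and tS: "(S \<longlongrightarrow> s) (at x within T)"
    using L S x unfolding l_def s_def continuous_on_def by auto
  \<comment> \<open>\<open>E\<close> arises from subtracting the cubic equations at y and x and
    dividing by L y - l; its limit is s^2. \<open>\<Phi>\<close> comes likewise from the difference
    of the equations for S^2.\<close>
  define E where "E = (\<lambda>y. 2 * (L y ^ 2 + L y * l + l ^ 2) + g x)"
  define \<Psi> where "\<Psi> = (\<lambda>y. - L y / E y)"
  define \<Phi> where "\<Phi> = (\<lambda>y. (6 * (L y + l) * \<Psi> y + 1) / (S y + s))"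
  have tE: "(E \<longlongrightarrow> s ^ 2) (at x within T)"
  proof -
    have "(E \<longlongrightarrow> 2 * (l ^ 2 + l * l + l ^ 2) + g x) (at x within T)"
      unfolding E_def by (intro tendsto_intros tL)
    then show ?thesis unfolding s2 by (simp add: power2_eq_square)
  qed
  have t\<Psi>: "(\<Psi> \<longlongrightarrow> - l / s ^ 2) (at x within T)"
    unfolding \<Psi>_def by (intro tendsto_intros tL tE) (use s0 in auto)
  have t\<Phi>: "(\<Phi> \<longlongrightarrow> (6 * (l + l) * (- l / s ^ 2) + 1) / (s + s)) (at x within T)"
    unfolding \<Phi>_def by (intro tendsto_intros tL tS t\<Psi>) (use s0 in auto)
  have "(\<lambda>y. L y / S y) x = l / s" by (simp add: l_def s_def)
  have ev: "\<forall>\<^sub>F y in at x within T. y \<in> T \<and> E y \<noteq> 0 \<and> S y + s \<noteq> 0"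
  proof (intro eventually_conj)
    show "\<forall>\<^sub>F y in at x within T. y \<in> T" by (simp add: eventually_at_filter)
    show "\<forall>\<^sub>F y in at x within T. E y \<noteq> 0" by (rule tendsto_imp_eventually_ne[OF tE]) (use s0 in simp)
    have "((\<lambda>y. S y + s) \<longlongrightarrow> s + s) (at x within T)" by (intro tendsto_intros tS)
    then show "\<forall>\<^sub>F y in at x within T. S y + s \<noteq> 0" by (rule tendsto_imp_eventually_ne) (use s0 in simp)
  qed
  have A: "((\<lambda>y. L y / S y) has_vector_derivative
      (g' * (((- l / s ^ 2) * s - l * ((6 * (l + l) * (- l / s ^ 2) + 1) / (s + s))) / (s * s)))) (at x within T)"
  proof (rule has_vector_derivative_factor[OF g])
    show "((\<lambda>y. (\<Psi> y * s - l * \<Phi> y) / (S y * s)) \<longlongrightarrow>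
      ((- l / s ^ 2) * s - l * ((6 * (l + l) * (- l / s ^ 2) + 1) / (s + s))) / (s * s)) (at x within T)"
      by (intro tendsto_intros t\<Psi> t\<Phi> tS) (use s0 in auto)
    show "\<forall>\<^sub>F y in at x within T. L y / S y - L x / S x = (g y - g x) * ((\<Psi> y * s - l * \<Phi> y) / (S y * s))"
      using ev
    proof eventually_elim
      case (elim y)
      have y: "2 * L y ^ 3 + g y * L y + c = 0" "S y ^ 2 = 6 * L y ^ 2 + g y" "S y \<noteq> 0"
        using os[of y] elim by (auto simp: on_surf_def)
      have "2 * l ^ 3 + g x * l + c = 0" using os[OF x] by (simp add: on_surf_def l_def)
      then have "(L y - l) * E y = - ((g y - g x) * L y)" unfolding E_def using y(1) by algebra
      then have dL: "L y - l = (g y - g x) * \<Psi> y" using elim by (simp add: \<Psi>_def field_simps)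
      have "(S y - s) * (S y + s) = 6 * (L y - l) * (L y + l) + (g y - g x)"
        using y(2) s2 by algebra
      also have "\<dots> = (g y - g x) * (6 * (L y + l) * \<Psi> y + 1)" unfolding dL by (simp add: algebra_simps)
      finally have dS: "S y - s = (g y - g x) * \<Phi> y" using elim by (simp add: \<Phi>_def field_simps)
      have "L y / S y - L x / S x = ((L y - l) * s - l * (S y - s)) / (S y * s)"
        using y(3) s0 by (simp add: l_def[symmetric] s_def[symmetric] field_simps)
      also have "\<dots> = (g y - g x) * ((\<Psi> y * s - l * \<Phi> y) / (S y * s))"
        unfolding dL dS by (simp add: algebra_simps)
      finally show ?case .
    qed
  qed
  have B: "((- l / s ^ 2) * s - l * ((6 * (l + l) * (- l / s ^ 2) + 1) / (s + s))) / (s * s)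
      = 3/2 * poly qp (l / s) / s ^ 2"
  proof -
    define z where "z = l / s"
    have l: "l = z * s" using s0 by (simp add: z_def)
    show ?thesis unfolding z_def[symmetric] unfolding l qp_def using s0
      by (simp add: field_simps power2_eq_square)
  qed
  show ?thesis using A unfolding B unfolding l_def s_def .
qed

lemma Rodd_integral_even:
  assumes ab: "a \<le> b" and c: "c \<noteq> 0" and j: "even j" "j \<ge> 2"
    and g: "\<And>u. u \<in> {a..b} \<Longrightarrow> (g has_vector_derivative g' u) (at u within {a..b})"
    and L: "continuous_on {a..b} L" and S: "continuous_on {a..b} S"
    and os: "\<And>u. u \<in> {a..b} \<Longrightarrow> on_surf c (g u) (L u) (S u)"
  shows "integral {a..b} (\<lambda>u. Rodd c j (g u) (L u) (S u) * g' u)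
    = (poly (vorosprim j) (L b / S b) - poly (vorosprim j) (L a / S a)) / c ^ (j - 1)"
proof -
  define H where "H = (\<lambda>u. poly (vorosprim j) (L u / S u) / c ^ (j - 1))"
  have "(H has_vector_derivative (Rodd c j (g u) (L u) (S u) * g' u)) (at u within {a..b})"
    if u: "u \<in> {a..b}" for u
  proof -
    define s x where "s = S u" and "x = L u / S u"
    have s0: "s \<noteq> 0" and cq: "c = s ^ 3 * poly qp x"
      using on_surfD[OF os[OF u]] by (simp_all add: s_def x_def)
    have q0: "poly qp x \<noteq> 0" using cq c by auto
    have r: "poly (Ric $ j) x = 3/2 * (poly qp x ^ 2 * poly (pderiv (vorosprim j)) x)"
      using arg_cong[OF vorosprim[OF j(2)], of "\<lambda>p. poly p x"] by simp
    have "((poly (vorosprim j) \<circ> (\<lambda>u. L u / S u)) has_vector_derivative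
       (g' u * (3/2 * poly qp x / s ^ 2) * poly (pderiv (vorosprim j)) x)) (at u within {a..b})"
      unfolding x_def s_def
      by (rule field_vector_diff_chain_within[OF lift_ratio_derivative[OF g[OF u] u L S os]])
         (auto intro: has_field_derivative_at_within poly_DERIV)
    then have "(H has_vector_derivative
       (g' u * (3/2 * poly qp x / s ^ 2) * poly (pderiv (vorosprim j)) x / c ^ (j - 1))) (at u within {a..b})"
      unfolding H_def o_def by (rule has_vector_derivative_divide)
    moreover have "g' u * (3/2 * poly qp x / s ^ 2) * poly (pderiv (vorosprim j)) x / c ^ (j - 1)
       = Rodd c j (g u) (L u) (S u) * g' u"
    proof -
      \<comment> \<open>Trading one factor c for s^3 q leaves exactly dx/dt = 3 q / (2 s^2).\<close>
      have cj: "c ^ j = (s ^ 3 * poly qp x) * c ^ (j - 1)"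
        using j(2) cq by (metis One_nat_def Suc_1 Suc_le_D diff_Suc_1 power_Suc)
      have "Rodd c j (g u) (L u) (S u) = s * (3/2 * (poly qp x ^ 2 * poly (pderiv (vorosprim j)) x)) / c ^ j"
        using j(1) unfolding Rodd_eq[OF os[OF u] c] val_def x_def[symmetric] r unfolding s_def[symmetric] by simp
      also have "\<dots> = (3/2 * poly qp x / s ^ 2) * poly (pderiv (vorosprim j)) x / c ^ (j - 1)"
        unfolding cj using s0 q0 c by (simp add: field_simps power2_eq_square power3_eq_cube)
      finally show ?thesis by simp
    qed
    ultimately show ?thesis by simp
  qed
  then have "((\<lambda>u. Rodd c j (g u) (L u) (S u) * g' u) has_integral (H b - H a)) {a..b}"
    using ab by (intro fundamental_theorem_of_calculus) auto
  then show ?thesis by (simp add: integral_unique H_def diff_divide_distrib)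
qed

lemma Rodd_integral_odd:
  assumes "c \<noteq> 0" "odd j" "\<And>u. u \<in> {a..b} \<Longrightarrow> on_surf c (g u) (L u) (S u)"
  shows "integral {a..b} (\<lambda>u. Rodd c j (g u) (L u) (S u) * g' u) = 0"
proof -
  have "integral {a..b} (\<lambda>u. Rodd c j (g u) (L u) (S u) * g' u) = integral {a..b} (\<lambda>u. 0)"
    by (rule integral_cong) (use assms in \<open>simp add: Rodd_eq\<close>)
  then show ?thesis by simp
qed

text \<open>For even j the derivative of P_j is even in x, and P_j vanishes at 0.\<close>

lemma poly_vorosprim_minus:
  assumes "even j" "j \<ge> 2"
  shows "poly (vorosprim j) (- x) = - poly (vorosprim j) x"
proof -
  have "rfl (Ric $ j) = Ric $ j" using par_Ric assms(1) by (simp add: par_def)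
  then have "smult (3/2) (qp ^ 2 * rfl (pderiv (vorosprim j))) = smult (3/2) (qp ^ 2 * pderiv (vorosprim j))"
    unfolding vorosprim[OF assms(2), symmetric] by (simp add: power2_eq_square)
  then have "smult (2/3) (smult (3/2) (qp ^ 2 * rfl (pderiv (vorosprim j))))
      = smult (2/3) (smult (3/2) (qp ^ 2 * pderiv (vorosprim j)))" by simp
  then have "qp ^ 2 * rfl (pderiv (vorosprim j)) = qp ^ 2 * pderiv (vorosprim j)"
    unfolding smult_smult by simp
  moreover have "qp ^ 2 \<noteq> 0" by (simp add: qp_def)
  ultimately have "rfl (pderiv (vorosprim j)) = pderiv (vorosprim j)" by (metis mult_left_cancel)
  then have "pderiv (rfl (vorosprim j)) = pderiv (- vorosprim j)"
    unfolding rfl_pderiv by (simp add: pderiv_minus minus_equation_iff[of "pderiv (rfl _)"])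
  moreover have "poly (rfl (vorosprim j)) 0 = poly (- vorosprim j) 0" by (simp add: poly_rfl)
  ultimately have "rfl (vorosprim j) = - vorosprim j" by (rule poly_eqI_pderiv)
  then show ?thesis using poly_rfl[of "vorosprim j" x] by simp
qed

theorem mainTheorem1:
  shows "\<exists>\<delta>>0. \<forall>c g g' Lg Sg \<epsilon> l l' Ll Sl.
    c \<noteq> 0 \<and> \<bar>Arg c - pi / 2\<bar> < \<delta> \<and>
    \<comment> \<open>Gamma: the P-Stokes curve from tau_1 to infinity, with lift (Lg, Sg) = (lambda_0, sqrt Delta)\<close>
    g 0 = tau1 c \<and> continuous_on {0..} g \<and>
    (\<forall>u>0. (g has_vector_derivative g' u) (at u)) \<and> continuous_on {0<..} g' \<and>
    continuous_on {0..} Lg \<and> continuous_on {0..} Sg \<and>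
    (\<forall>u\<ge>0. 2 * Lg u ^ 3 + g u * Lg u + c = 0 \<and> Sg u ^ 2 = 6 * Lg u ^ 2 + g u) \<and>
    (\<forall>u>0. Sg u \<noteq> 0) \<and>
    (\<forall>u>0. \<exists>I. ((\<lambda>v. Sg v * g' v) has_integral I) {0..u} \<and> Im I = 0) \<and>
    filterlim (\<lambda>u. cmod (g u)) at_top at_top \<and>
    ((\<lambda>u. Lg u / csqrt (g u)) \<longlongrightarrow> - \<i> / complex_of_real (sqrt 2)) at_top \<and>
    ((\<lambda>u. Sg u / csqrt (g u)) \<longlongrightarrow> - complex_of_real (sqrt 2) * \<i>) at_top \<and>
    \<comment> \<open>loop around tau_1 from the sheet -sqrt Delta to the sheet +sqrt Delta at the point g eps\<close>
    \<epsilon> > 0 \<and> l 0 = g \<epsilon> \<and> l 1 = g \<epsilon> \<and> continuous_on {0..1} l \<and>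
    (\<forall>u\<in>{0..1}. (l has_vector_derivative l' u) (at u within {0..1})) \<and> continuous_on {0..1} l' \<and>
    (\<forall>u\<in>{0..1}. l u \<noteq> tau1 c \<and> cmod (l u - tau1 c) < sqrt 3 * cmod (tau1 c)) \<and>
    continuous_on {0..1} Ll \<and> continuous_on {0..1} Sl \<and>
    (\<forall>u\<in>{0..1}. on_surf c (l u) (Ll u) (Sl u)) \<and>
    Ll 0 = Lg \<epsilon> \<and> Sl 0 = - Sg \<epsilon> \<and> Ll 1 = Lg \<epsilon> \<and> Sl 1 = Sg \<epsilon>
    \<longrightarrow> (\<forall>j\<ge>1. ((\<lambda>b. (1/2) *
            ( - integral {\<epsilon>..b} (\<lambda>u. Rodd c j (g u) (Lg u) (- Sg u) * g' u)
              + integral {0..1} (\<lambda>u. Rodd c j (l u) (Ll u) (Sl u) * l' u)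
              + integral {\<epsilon>..b} (\<lambda>u. Rodd c j (g u) (Lg u) (Sg u) * g' u)))
          \<longlongrightarrow> W_target c j) at_top)"
proof (intro exI[of _ 1] conjI allI impI, simp, elim conjE)
  fix c :: complex and g g' Lg Sg and \<epsilon> :: real and l l' Ll Sl and j :: nat
  assume j: "j \<ge> 1" and c: "c \<noteq> 0"
    and g: "\<forall>u>0. (g has_vector_derivative g' u) (at u)"
    and Lg: "continuous_on {0..} Lg" and Sg: "continuous_on {0..} Sg"
    and eq: "\<forall>u\<ge>0. 2 * Lg u ^ 3 + g u * Lg u + c = 0 \<and> Sg u ^ 2 = 6 * Lg u ^ 2 + g u"
    and S0: "\<forall>u>0. Sg u \<noteq> 0"
    and Linf: "((\<lambda>u. Lg u / csqrt (g u)) \<longlongrightarrow> - \<i> / complex_of_real (sqrt 2)) at_top"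
    and Sinf: "((\<lambda>u. Sg u / csqrt (g u)) \<longlongrightarrow> - complex_of_real (sqrt 2) * \<i>) at_top"
    and \<epsilon>: "\<epsilon> > 0"
    and l: "\<forall>u\<in>{0..1}. (l has_vector_derivative l' u) (at u within {0..1})"
    and Ll: "continuous_on {0..1} Ll" and Sl: "continuous_on {0..1} Sl"
    and osl: "\<forall>u\<in>{0..1}. on_surf c (l u) (Ll u) (Sl u)"
    and ends: "Ll 0 = Lg \<epsilon>" "Sl 0 = - Sg \<epsilon>" "Ll 1 = Lg \<epsilon>" "Sl 1 = Sg \<epsilon>"
    and ginf: "filterlim (\<lambda>u. cmod (g u)) at_top at_top"
  have osg: "on_surf c (g u) (Lg u) (Sg u)" "on_surf c (g u) (Lg u) (- Sg u)" if "u \<in> {\<epsilon>..b}" for u b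
    using eq S0 that \<epsilon> by (auto simp: on_surf_def)
  have gd: "(g has_vector_derivative g' u) (at u within {\<epsilon>..b})" if "u \<in> {\<epsilon>..b}" for u b
    using g that \<epsilon> by (auto intro: has_vector_derivative_at_within)
  have cL: "continuous_on {\<epsilon>..b} Lg" and cS: "continuous_on {\<epsilon>..b} Sg" for b
    using Lg Sg \<epsilon> by (auto elim: continuous_on_subset)
  let ?I = "\<lambda>b. (1/2) *
            ( - integral {\<epsilon>..b} (\<lambda>u. Rodd c j (g u) (Lg u) (- Sg u) * g' u)
              + integral {0..1} (\<lambda>u. Rodd c j (l u) (Ll u) (Sl u) * l' u)
              + integral {\<epsilon>..b} (\<lambda>u. Rodd c j (g u) (Lg u) (Sg u) * g' u))"
  show "(?I \<longlongrightarrow> W_target c j) at_top"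
  proof (cases "even j")
    case False
    have "?I b = 0" for b
    proof -
      have 1: "integral {\<epsilon>..b} (\<lambda>u. Rodd c j (g u) (Lg u) (- Sg u) * g' u) = 0"
        by (rule Rodd_integral_odd[OF c False osg(2)])
      have 2: "integral {\<epsilon>..b} (\<lambda>u. Rodd c j (g u) (Lg u) (Sg u) * g' u) = 0"
        by (rule Rodd_integral_odd[OF c False osg(1)])
      have 3: "integral {0..1} (\<lambda>u. Rodd c j (l u) (Ll u) (Sl u) * l' u) = 0"
        by (rule Rodd_integral_odd[OF c False]) (use osl in auto)
      show ?thesis unfolding 1 2 3 by simp
    qed
    then show ?thesis using False by (simp add: W_target_def)
  next
    case True
    then have j2: "j \<ge> 2" using j by (cases "j = 1") auto
    let ?P = "poly (vorosprim j)"
    \<comment> \<open>Each of the two signed integrals along the curve contributes P_j at b minus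
      P_j at \<epsilon>, because P_j is odd. The loop contributes twice P_j at \<epsilon>, so all
      terms at \<epsilon> cancel.\<close>
    have I: "?I b = ?P (Lg b / Sg b) / c ^ (j - 1)" if b: "b \<ge> \<epsilon>" for b
    proof -
      have 1: "integral {\<epsilon>..b} (\<lambda>u. Rodd c j (g u) (Lg u) (- Sg u) * g' u)
        = (?P (Lg b / - Sg b) - ?P (Lg \<epsilon> / - Sg \<epsilon>)) / c ^ (j - 1)"
        by (rule Rodd_integral_even[OF b c True j2]) (use gd cL cS osg in \<open>auto intro: continuous_intros\<close>)
      have 2: "integral {\<epsilon>..b} (\<lambda>u. Rodd c j (g u) (Lg u) (Sg u) * g' u)
        = (?P (Lg b / Sg b) - ?P (Lg \<epsilon> / Sg \<epsilon>)) / c ^ (j - 1)"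
        by (rule Rodd_integral_even[OF b c True j2]) (use gd cL cS osg in auto)
      have 3: "integral {0..1} (\<lambda>u. Rodd c j (l u) (Ll u) (Sl u) * l' u)
        = (?P (Ll 1 / Sl 1) - ?P (Ll 0 / Sl 0)) / c ^ (j - 1)"
        by (rule Rodd_integral_even[OF _ c True j2]) (use l Ll Sl osl in auto)
      have m: "?P (y / - z) = - ?P (y / z)" for y z
        using poly_vorosprim_minus[OF True j2, of "y / z"] by simp
      show ?thesis unfolding 1 2 3 ends m by (simp add: add_divide_distrib diff_divide_distrib)
    qed
    have "((\<lambda>u. (Lg u / csqrt (g u)) / (Sg u / csqrt (g u))) \<longlongrightarrow>
        (- \<i> / complex_of_real (sqrt 2)) / (- complex_of_real (sqrt 2) * \<i>)) at_top"
      by (intro tendsto_divide Linf Sinf) simp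
    also have "(- \<i> / complex_of_real (sqrt 2)) / (- complex_of_real (sqrt 2) * \<i>) = 1/2"
      by (simp add: field_simps of_real_mult[symmetric] del: of_real_mult)
    finally have "((\<lambda>u. Lg u / Sg u) \<longlongrightarrow> 1/2) at_top"
    proof (rule Lim_transform_eventually)
      \<comment> \<open>Far out on the curve \<open>g\<close> is nonzero, so the square root cancels
        from the quotient.\<close>
      have "\<forall>\<^sub>F u in at_top. cmod (g u) \<ge> 1" using ginf by (simp add: filterlim_at_top)
      then show "\<forall>\<^sub>F u in at_top. Lg u / csqrt (g u) / (Sg u / csqrt (g u)) = Lg u / Sg u"
        by eventually_elim auto
    qed
    then have "((\<lambda>u. ?P (Lg u / Sg u) / c ^ (j - 1)) \<longlongrightarrow> ?P (1/2) / c ^ (j - 1)) at_top"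
      by (rule tendsto_divide[OF tendsto_poly tendsto_const]) (use c in auto)
    moreover have "\<forall>\<^sub>F b in at_top. ?P (Lg b / Sg b) / c ^ (j - 1) = ?I b"
      using eventually_ge_at_top[of \<epsilon>] by eventually_elim (simp only: I)
    ultimately have "(?I \<longlongrightarrow> ?P (1/2) / c ^ (j - 1)) at_top"
      by (rule Lim_transform_eventually)
    also have "?P (1/2) / c ^ (j - 1) = W_target c j"
      unfolding W_target_def voros_eq[OF j2 True] using True by (simp add: divide_inverse)
    finally show ?thesis .
  qed
qed

end
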